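(* For every pair of integers $n\geqslant 4$ and $2\leqslant k\leqslant n-2$, there is a Nakano positive Hermitian $k\times k$ matrix $M$ of constant $(1,1)$-forms on $\mathbb{C}^n$ such that the Lefschetz map $L_{\det M}^{1,n-k-1}$ is not an isomorphism. In particular, $\det M$ belongs to the Griffiths cone but not to the Hodge--Riemann cone (for any choice of Kähler reference form $\omega$): $\det M$ is not Hodge--Riemann.
   Context: Let $V=\mathbb{C}^n$ with complex coordinates $z_1,\dots,z_n$, and let $V^{p,q}=\Lambda^pV^*\otimes\Lambda^q\overline{V^*}$ be the space of constant-coefficient $(p,q)$-forms. For $\Omega\in V^{k,k}$ and nonnegative integers $p,q$ with $p+q=n-k$, the Lefschetz map is $L_\Omega^{p,q}\colon V^{p,q}\to V^{n-q,n-p}$, $\alpha\mapsto\alpha\wedge\Omega$. A Hermitian $k\times k$ matrix of constant $(1,1)$-forms is $M=(\alpha_{ab})_{a,b=1}^k$ with $\alpha_{ba}=\overline{\alpha_{ab}}$. Write $\alpha_{ab}=\frac{\sqrt{-1}}{2}\sum_{\mu,\nu=1}^n A_{a\bar b\mu\bar\nu}\,dz_\mu\wedge d\bar z_\nu$. Since $(1,1)$-forms commute under the wedge product, $\det M$ is defined by the usual permutation formula; it is a real $(k,k)$-form. A real constant $(1,1)$-form is Kähler if its associated Hermitian form is positive definite, i.e. it equals $\frac{\sqrt{-1}}{2}\sum_j dw_j\wedge d\bar w_j$ in some complex linear coordinates $w_j$. $M$ is Griffiths positive if $\sum_{a,b}\theta_a\overline{\theta_b}\,\alpha_{ab}$ is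 Kähler for every $0\ne\theta\in\mathbb{C}^k$. The Griffiths cone is the set of forms $\det M$ with $M$ a Griffiths positive $k\times k$ matrix. $M$ is Nakano positive if $\sum_{a,b,\mu,\nu}A_{a\bar b\mu\bar\nu}u_{a\mu}\overline{u_{b\nu}}>0$ for every $0\ne u\in\mathbb{C}^k\otimes\mathbb{C}^n$. Fix a Kähler form $\omega$ (the reference form). A real $(k,k)$-form $\Omega$ is Lefschetz for $(p,q)$ (where $p+q=n-k$) if $L_\Omega^{p,q}$ is an isomorphism. It is Hodge--Riemann for $(p,q)$ if there is a continuous path of real $(k,k)$-forms $\Omega_t$, $0\leqslant t\leqslant1$, with $\Omega_0=\Omega$, $\Omega_1=\omega^k$, such that $\Omega_t\wedge\omega^{2r}$ is Lefschetz for $(p-r,q-r)$ for every integer $0\leqslant r\leqslant\min\{p,q\}$ and every $t\in[0,1]$. It is Hodge--Riemann (belongs to the Hodge--Riemann cone) if it is Hodge--Riemann for $(p,q)$ for every $p+q=n-k$. *)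

theory Defs
  imports "HOL-Analysis.Analysis" "HOL-Combinatorics.Permutations"
begin

text \<open>
  A constant-coefficient form on the space with coordinates indexed by \<open>{..<n}\<close> is represented
  by its coefficients: \<open>\<alpha> I J\<close> is the coefficient of \<open>dz\<^sub>I \<and> d\<bar>z\<^sub>J\<close>, the wedge
  products \<open>dz\<^sub>I\<close> and \<open>d\<bar>z\<^sub>J\<close> being taken in increasing order of the indices.
\<close>

type_synonym form = "nat set \<Rightarrow> nat set \<Rightarrow> complex"

definition forms :: "nat \<Rightarrow> nat \<Rightarrow> nat \<Rightarrow> form set" where
  "forms n p q = {\<alpha>. \<forall>I J. \<alpha> I J \<noteq> 0 \<longrightarrow>
     I \<subseteq> {..<n} \<and> J \<subseteq> {..<n} \<and> card I = p \<and> card J = q}"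

text \<open>The sign with \<open>dz\<^sub>I \<and> dz\<^sub>J = shuffle_sign I J dz\<^bsub>I \<union> J\<^esub>\<close>, for disjoint \<open>I\<close> and \<open>J\<close>.\<close>

definition shuffle_sign :: "nat set \<Rightarrow> nat set \<Rightarrow> complex" where
  "shuffle_sign I J = (-1) ^ card {(i, j). i \<in> I \<and> j \<in> J \<and> j < i}"

text \<open>
  The factor \<open>(-1) ^ (card J * card (K - I))\<close> comes from moving \<open>d\<bar>z\<^sub>J\<close> past
  \<open>dz\<^bsub>K - I\<^esub>\<close> in
  \<open>(dz\<^sub>I \<and> d\<bar>z\<^sub>J) \<and> (dz\<^bsub>K - I\<^esub> \<and> d\<bar>z\<^bsub>L - J\<^esub>)\<close>.
\<close>

definition wedge :: "form \<Rightarrow> form \<Rightarrow> form" where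
  "wedge \<alpha> \<beta> = (\<lambda>K L. \<Sum>I\<in>Pow K. \<Sum>J\<in>Pow L.
     (-1) ^ (card J * card (K - I)) * shuffle_sign I (K - I) * shuffle_sign J (L - J)
       * \<alpha> I J * \<beta> (K - I) (L - J))"

definition form_one :: form where
  "form_one = (\<lambda>I J. if I = {} \<and> J = {} then 1 else 0)"

definition form_pow :: "form \<Rightarrow> nat \<Rightarrow> form" where
  "form_pow \<omega> m = (wedge \<omega> ^^ m) form_one"

text \<open>
  Complex conjugation maps \<open>c dz\<^sub>J \<and> d\<bar>z\<^sub>I\<close> to
  \<open>cnj c d\<bar>z\<^sub>J \<and> dz\<^sub>I = (-1) ^ (card I * card J) cnj c dz\<^sub>I \<and> d\<bar>z\<^sub>J\<close>.
\<close>

definition form_cnj :: "form \<Rightarrow> form" where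
  "form_cnj \<alpha> = (\<lambda>I J. (-1) ^ (card I * card J) * cnj (\<alpha> J I))"

definition real_forms :: "nat \<Rightarrow> nat \<Rightarrow> form set" where
  "real_forms n k = {\<Omega> \<in> forms n k k. form_cnj \<Omega> = \<Omega>}"

text \<open>
  The Lefschetz map is linear (see \<open>wedge_add_left\<close> and \<open>wedge_scale_left\<close> below), so it is an
  isomorphism iff it is bijective.
\<close>

definition lefschetz_map :: "form \<Rightarrow> form \<Rightarrow> form" where
  "lefschetz_map \<Omega> = (\<lambda>\<alpha>. wedge \<alpha> \<Omega>)"

definition lefschetz :: "nat \<Rightarrow> form \<Rightarrow> nat \<Rightarrow> nat \<Rightarrow> bool" where
  "lefschetz n \<Omega> p q \<longleftrightarrow> bij_betw (lefschetz_map \<Omega>) (forms n p q) (forms n (n - q) (n - p))"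

text \<open>The coefficient \<open>A\<^bsub>\<mu>\<nu>\<^esub>\<close> in \<open>\<alpha> = \<i>/2 \<Sum> A\<^bsub>\<mu>\<nu>\<^esub> dz\<^sub>\<mu> \<and> d\<bar>z\<^sub>\<nu>\<close>.\<close>

definition herm_coeff :: "form \<Rightarrow> nat \<Rightarrow> nat \<Rightarrow> complex" where
  "herm_coeff \<alpha> \<mu> \<nu> = \<alpha> {\<mu>} {\<nu>} / (\<i> / 2)"

text \<open>The sum below is real because \<open>\<alpha>\<close> is; likewise in \<open>nakano_positive\<close>.\<close>

definition kaehler :: "nat \<Rightarrow> form \<Rightarrow> bool" where
  "kaehler n \<alpha> \<longleftrightarrow> \<alpha> \<in> real_forms n 1 \<and>
     (\<forall>u :: nat \<Rightarrow> complex. (\<exists>\<mu><n. u \<mu> \<noteq> 0) \<longrightarrow>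
        0 < Re (\<Sum>\<mu><n. \<Sum>\<nu><n. herm_coeff \<alpha> \<mu> \<nu> * u \<mu> * cnj (u \<nu>)))"

text \<open>For matrices of forms, only the entries with indices below \<open>k\<close> are relevant.\<close>

definition herm_matrix :: "nat \<Rightarrow> nat \<Rightarrow> (nat \<Rightarrow> nat \<Rightarrow> form) \<Rightarrow> bool" where
  "herm_matrix n k M \<longleftrightarrow>
     (\<forall>a<k. \<forall>b<k. M a b \<in> forms n 1 1 \<and> M b a = form_cnj (M a b))"

definition form_det :: "nat \<Rightarrow> (nat \<Rightarrow> nat \<Rightarrow> form) \<Rightarrow> form" where
  "form_det k M = (\<lambda>I J. \<Sum>\<sigma> | \<sigma> permutes {..<k}.
     of_int (sign \<sigma>) * foldr wedge (map (\<lambda>a. M a (\<sigma> a)) [0..<k]) form_one I J)"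

definition griffiths_positive :: "nat \<Rightarrow> nat \<Rightarrow> (nat \<Rightarrow> nat \<Rightarrow> form) \<Rightarrow> bool" where
  "griffiths_positive n k M \<longleftrightarrow> herm_matrix n k M \<and>
     (\<forall>\<theta> :: nat \<Rightarrow> complex. (\<exists>a<k. \<theta> a \<noteq> 0) \<longrightarrow>
        kaehler n (\<lambda>I J. \<Sum>a<k. \<Sum>b<k. \<theta> a * cnj (\<theta> b) * M a b I J))"

definition griffiths_cone :: "nat \<Rightarrow> nat \<Rightarrow> form set" where
  "griffiths_cone n k = {form_det k M | M. griffiths_positive n k M}"

definition nakano_positive :: "nat \<Rightarrow> nat \<Rightarrow> (nat \<Rightarrow> nat \<Rightarrow> form) \<Rightarrow> bool" where
  "nakano_positive n k M \<longleftrightarrow> herm_matrix n k M \<and>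
     (\<forall>u :: nat \<Rightarrow> nat \<Rightarrow> complex. (\<exists>a<k. \<exists>\<mu><n. u a \<mu> \<noteq> 0) \<longrightarrow>
        0 < Re (\<Sum>a<k. \<Sum>b<k. \<Sum>\<mu><n. \<Sum>\<nu><n.
                  herm_coeff (M a b) \<mu> \<nu> * u a \<mu> * cnj (u b \<nu>)))"

text \<open>
  The type \<^typ>\<open>form\<close> carries the product topology, which induces the usual topology on the
  finite-dimensional subspaces \<^term>\<open>forms n k k\<close>.
\<close>

definition hodge_riemann_for :: "nat \<Rightarrow> nat \<Rightarrow> form \<Rightarrow> form \<Rightarrow> nat \<Rightarrow> nat \<Rightarrow> bool" where
  "hodge_riemann_for n k \<omega> \<Omega> p q \<longleftrightarrow>
     (\<exists>\<gamma> :: real \<Rightarrow> form. path \<gamma> \<and> pathstart \<gamma> = \<Omega> \<and> pathfinish \<gamma> = form_pow \<omega> k \<and>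
        (\<forall>t\<in>{0..1}. \<gamma> t \<in> real_forms n k \<and>
           (\<forall>r\<le>min p q. lefschetz n (wedge (\<gamma> t) (form_pow \<omega> (2 * r))) (p - r) (q - r))))"

definition hodge_riemann_cone :: "nat \<Rightarrow> nat \<Rightarrow> form \<Rightarrow> form set" where
  "hodge_riemann_cone n k \<omega> =
     {\<Omega> \<in> real_forms n k. \<forall>p q. p + q + k = n \<longrightarrow> hodge_riemann_for n k \<omega> \<Omega> p q}"

lemma wedge_add_left:
  "wedge (\<lambda>I J. \<alpha> I J + \<beta> I J) \<Omega> = (\<lambda>K L. wedge \<alpha> \<Omega> K L + wedge \<beta> \<Omega> K L)"
  by (simp add: wedge_def algebra_simps sum.distrib)

lemma wedge_scale_left:
  "wedge (\<lambda>I J. c * \<alpha> I J) \<Omega> = (\<lambda>K L. c * wedge \<alpha> \<Omega> K L)"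
  by (simp add: wedge_def algebra_simps sum_distrib_left)

lemma wedge_in_forms:
  assumes "\<alpha> \<in> forms n p q" and "\<beta> \<in> forms n r s"
  shows "wedge \<alpha> \<beta> \<in> forms n (p + r) (q + s)"
proof -
  have "K \<subseteq> {..<n} \<and> L \<subseteq> {..<n} \<and> card K = p + r \<and> card L = q + s"
    if nz: "wedge \<alpha> \<beta> K L \<noteq> 0" for K L
  proof -
    obtain I where I: "I \<subseteq> K" and "(\<Sum>J\<in>Pow L.
       (-1) ^ (card J * card (K - I)) * shuffle_sign I (K - I) * shuffle_sign J (L - J)
         * \<alpha> I J * \<beta> (K - I) (L - J)) \<noteq> 0"
      using nz unfolding wedge_def by (meson PowD sum.not_neutral_contains_not_neutral)
    then obtain J where J: "J \<subseteq> L" and "\<alpha> I J * \<beta> (K - I) (L - J) \<noteq> 0"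
      by (metis (no_types, lifting) PowD mult.assoc mult_zero_right
          sum.not_neutral_contains_not_neutral)
    then have sub: "I \<subseteq> {..<n}" "J \<subseteq> {..<n}" "K - I \<subseteq> {..<n}" "L - J \<subseteq> {..<n}"
      and card: "card I = p" "card J = q" "card (K - I) = r" "card (L - J) = s"
      using assms unfolding forms_def by (auto dest!: spec)
    have KL: "K = I \<union> (K - I)" "L = J \<union> (L - J)"
      using I J by auto
    have "card K = p + r"
      using card sub by (subst KL(1), subst card_Un_disjoint) (auto intro: finite_subset)
    moreover have "card L = q + s"
      using card sub by (subst KL(2), subst card_Un_disjoint) (auto intro: finite_subset)
    ultimately show ?thesis
      using sub by blast
  qed
  then show ?thesis
    unfolding forms_def by blast
qed

end

theory Submission
  imports Defs
begin

text \<open>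
  Write \<open>e\<^sub>j = \<i>/2 dz\<^sub>j \<and> d\<bar>z\<^sub>j\<close> and \<open>\<omega> = \<Sum>\<^sub>j e\<^sub>j\<close>, with indices starting from 0. Let \<open>M\<close> have \<open>\<omega>\<close> on the
  diagonal, except for \<open>\<omega> + T (e\<^sub>1 + e\<^sub>3)\<close> at position \<open>(1, 1)\<close>, and let its only other nonzero
  entries be \<open>p \<i>/2 (dz\<^sub>0 \<and> d\<bar>z\<^sub>1 + dz\<^sub>2 \<and> d\<bar>z\<^sub>3)\<close> at \<open>(0, 1)\<close> and the conjugate entry at \<open>(1, 0)\<close>. The matrix is
  Nakano positive as soon as \<open>p\<^sup>2 < 1 + T\<close>. Up to cross terms, each of which contains
  \<open>dz\<^sub>j\<close> or \<open>d\<bar>z\<^sub>j\<close> for every \<open>j < 4\<close>, the determinant is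
  \<open>\<omega>\<^sup>k + T (e\<^sub>1 + e\<^sub>3) \<omega>\<^bsup>k - 1\<^esup> + p\<^sup>2 (e\<^sub>0 e\<^sub>1 + e\<^sub>2 e\<^sub>3) \<omega>\<^bsup>k - 2\<^esup>\<close>.
  Consider \<open>\<alpha> = (e\<^sub>0 - e\<^sub>2 + N (e\<^sub>1 - e\<^sub>3)) \<and> d\<bar>z\<^sub>J\<close> with \<open>J = {k + 2..<n}\<close>. Multiplication by
  \<open>d\<bar>z\<^sub>J\<close> removes the variables in \<open>J\<close>, multiplication by \<open>\<alpha>\<close> kills the cross terms, and
  \<open>\<alpha> \<and> det M = 0\<close> reduces to the two equations \<open>p\<^sup>2 = N k (k - 1)\<close> and
  \<open>N p\<^sup>2 = k (k - 1) + 2 T (k - 1)\<close>. For \<open>N = 2 k - 1\<close> they give \<open>T = 2 k\<^sup>2 (k - 1)\<close>, and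
  then \<open>p\<^sup>2 < 1 + T\<close> holds.
\<close>

section \<open>Wedge products with (1,1)-forms\<close>

text \<open>The factor \<open>\<i> / 2\<close> is the one that \<open>herm_coeff\<close> divides
  out, so on indices below \<open>n\<close> the function \<open>A\<close> is the Hermitian
  coefficient matrix of the form.\<close>

definition form11 :: "nat \<Rightarrow> (nat \<Rightarrow> nat \<Rightarrow> complex) \<Rightarrow> form" where
  "form11 n A = (\<lambda>I J. if \<exists>\<mu><n. \<exists>\<nu><n. I = {\<mu>} \<and> J = {\<nu>}
     then \<i> / 2 * A (the_elem I) (the_elem J) else 0)"

text \<open>
  \<open>e\<^sub>I = diag_sign (card I) dz\<^sub>I \<and> d\<bar>z\<^sub>I\<close> for the product \<open>e\<^sub>I\<close> of the \<open>e\<^sub>j\<close> with \<open>j \<in> I\<close>, so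
  \<open>diag_form n w\<close> below is \<open>\<Sum>\<^sub>I w I e\<^sub>I\<close>.
\<close>

definition diag_sign :: "nat \<Rightarrow> complex" where
  "diag_sign m = (\<Prod>j<m. \<i> / 2 * (-1) ^ j)"

definition diag_form :: "nat \<Rightarrow> (nat set \<Rightarrow> complex) \<Rightarrow> form" where
  "diag_form n w = (\<lambda>I J. if I = J \<and> I \<subseteq> {..<n} then diag_sign (card I) * w I else 0)"

lemma form11_singleton [simp]:
  "form11 n A {\<mu>} {\<nu>} = (if \<mu> < n \<and> \<nu> < n then \<i> / 2 * A \<mu> \<nu> else 0)"
  by (auto simp: form11_def)

lemma form11_in_forms: "form11 n A \<in> forms n 1 1"
  by (auto simp: form11_def forms_def)

lemma form11_eq_0: "\<not> is_singleton I \<or> \<not> is_singleton J \<Longrightarrow> form11 n A I J = 0"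
  by (auto simp: form11_def is_singleton_def)

text \<open>The sign -1 that \<open>form_cnj\<close> carries in bidegree (1,1) cancels the sign from
  conjugating i/2, so no sign is left.\<close>

lemma form_cnj_form11: "form_cnj (form11 n A) = form11 n (\<lambda>\<mu> \<nu>. cnj (A \<nu> \<mu>))"
proof (intro ext)
  fix I J
  show "form_cnj (form11 n A) I J = form11 n (\<lambda>\<mu> \<nu>. cnj (A \<nu> \<mu>)) I J"
  proof (cases "is_singleton I \<and> is_singleton J")
    case True
    then obtain \<mu> \<nu> where "I = {\<mu>}" "J = {\<nu>}"
      by (auto simp: is_singleton_def)
    then show ?thesis by (simp add: form_cnj_def)
  next
    case False
    then have "form11 n A J I = 0" "form11 n (\<lambda>\<mu> \<nu>. cnj (A \<nu> \<mu>)) I J = 0"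
      by (intro form11_eq_0; blast)+
    then show ?thesis by (simp add: form_cnj_def)
  qed
qed

lemma sum_Pow_singletons:
  assumes "finite K" "\<And>I. I \<subseteq> K \<Longrightarrow> \<not> is_singleton I \<Longrightarrow> f I = (0 :: 'a :: comm_monoid_add)"
  shows "(\<Sum>I\<in>Pow K. f I) = (\<Sum>\<mu>\<in>K. f {\<mu>})"
proof -
  have "(\<Sum>I\<in>Pow K. f I) = (\<Sum>I\<in>(\<lambda>\<mu>. {\<mu>}) ` K. f I)"
    using assms by (intro sum.mono_neutral_right) (auto simp: is_singleton_def image_iff)
  also have "\<dots> = (\<Sum>\<mu>\<in>K. f {\<mu>})"
    by (subst sum.reindex) (auto simp: inj_on_def)
  finally show ?thesis .
qed

lemma wedge_infinite: "infinite K \<or> infinite L \<Longrightarrow> wedge \<alpha> \<beta> K L = 0"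
  by (auto simp: wedge_def)

lemma wedge_zero_left: "wedge (\<lambda>_ _. 0) \<beta> = (\<lambda>_ _. 0)"
  by (simp add: wedge_def)

lemma wedge_zero_right: "wedge \<alpha> (\<lambda>_ _. 0) = (\<lambda>_ _. 0)"
  by (simp add: wedge_def)

lemma shuffle_sign_square: "shuffle_sign I J * shuffle_sign I J = 1"
  by (simp add: shuffle_sign_def flip: power_add mult_2)

lemma shuffle_sign_singleton: "shuffle_sign {i} J = (-1) ^ card {j \<in> J. j < i}"
proof -
  have "{(i', j). i' \<in> {i} \<and> j \<in> J \<and> j < i'} = Pair i ` {j \<in> J. j < i}"
    by auto
  then show ?thesis
    by (simp add: shuffle_sign_def card_image inj_on_def)
qed

text \<open>Since the left factor has bidegree (1,1), only singletons \<open>I\<close> and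
  \<open>J\<close> contribute. Moving its one conjugate differential past the other
  \<open>card K - 1\<close> holomorphic ones gives the power of -1.\<close>

lemma wedge_form11:
  assumes "finite K" "finite L"
  shows "wedge (form11 n A) \<beta> K L = (\<Sum>\<mu>\<in>K. \<Sum>\<nu>\<in>L.
     (-1) ^ (card K - 1) * shuffle_sign {\<mu>} (K - {\<mu>}) * shuffle_sign {\<nu>} (L - {\<nu>})
       * form11 n A {\<mu>} {\<nu>} * \<beta> (K - {\<mu>}) (L - {\<nu>}))"
proof -
  let ?t = "\<lambda>I J. (-1) ^ (card J * card (K - I)) * shuffle_sign I (K - I)
        * shuffle_sign J (L - J) * form11 n A I J * \<beta> (K - I) (L - J)"
  have "wedge (form11 n A) \<beta> K L = (\<Sum>\<mu>\<in>K. \<Sum>J\<in>Pow L. ?t {\<mu>} J)"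
    unfolding wedge_def
    by (rule sum_Pow_singletons[OF assms(1)], rule sum.neutral) (simp add: form11_eq_0)
  also have "\<dots> = (\<Sum>\<mu>\<in>K. \<Sum>\<nu>\<in>L. ?t {\<mu>} {\<nu>})"
    by (intro sum.cong[OF refl] sum_Pow_singletons[OF assms(2)]) (simp add: form11_eq_0)
  also have "\<dots> = (\<Sum>\<mu>\<in>K. \<Sum>\<nu>\<in>L.
     (-1) ^ (card K - 1) * shuffle_sign {\<mu>} (K - {\<mu>}) * shuffle_sign {\<nu>} (L - {\<nu>})
       * form11 n A {\<mu>} {\<nu>} * \<beta> (K - {\<mu>}) (L - {\<nu>}))"
    using assms by (intro sum.cong[OF refl]) simp
  finally show ?thesis .
qed

lemma diag_sign_Suc: "diag_sign (Suc m) = \<i> / 2 * (-1) ^ m * diag_sign m"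
  by (simp add: diag_sign_def)

text \<open>Only \<mu> = \<nu> and K = L survive; then the two shuffle signs agree and square to 1,
  and \<open>diag_sign_Suc\<close> absorbs the remaining sign. Products of diagonal forms thus
  become sign-free sums over subsets.\<close>

lemma wedge_diag:
  "wedge (form11 n (\<lambda>\<mu> \<nu>. if \<mu> = \<nu> then a \<mu> else 0)) (diag_form n w)
     = diag_form n (\<lambda>K. \<Sum>\<mu>\<in>K. a \<mu> * w (K - {\<mu>}))"
proof (intro ext)
  fix K L :: "nat set"
  let ?A = "form11 n (\<lambda>\<mu> \<nu>. if \<mu> = \<nu> then a \<mu> else 0)"
  let ?D = "diag_form n (\<lambda>K. \<Sum>\<mu>\<in>K. a \<mu> * w (K - {\<mu>}))"
  consider "infinite K \<or> infinite L" | "finite K" "finite L" by blast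
  then show "wedge ?A (diag_form n w) K L = ?D K L"
  proof cases
    case 1
    then have "?D K L = 0"
      by (auto simp: diag_form_def dest: finite_subset[OF _ finite_lessThan])
    with 1 show ?thesis by (simp add: wedge_infinite)
  next
    case 2
    let ?t = "\<lambda>\<mu> \<nu>. (-1) ^ (card K - 1) * shuffle_sign {\<mu>} (K - {\<mu>}) * shuffle_sign {\<nu>} (L - {\<nu>})
       * ?A {\<mu>} {\<nu>} * diag_form n w (K - {\<mu>}) (L - {\<nu>})"
    have eq: "wedge ?A (diag_form n w) K L = (\<Sum>\<mu>\<in>K. \<Sum>\<nu>\<in>L. ?t \<mu> \<nu>)"
      using 2 by (rule wedge_form11)
    show ?thesis
    proof (cases "K = L \<and> K \<subseteq> {..<n}")
      case False
      have "?t \<mu> \<nu> = 0" if "\<mu> \<in> K" "\<nu> \<in> L" for \<mu> \<nu>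
        using that False by (auto simp: diag_form_def)
      then have "(\<Sum>\<mu>\<in>K. \<Sum>\<nu>\<in>L. ?t \<mu> \<nu>) = 0"
        by (intro sum.neutral ballI)
      moreover have "?D K L = 0"
        using False by (auto simp: diag_form_def)
      ultimately show ?thesis unfolding eq by simp
    next
      case True
      have "(\<Sum>\<nu>\<in>L. ?t \<mu> \<nu>) = diag_sign (card K) * (a \<mu> * w (K - {\<mu>}))" if "\<mu> \<in> K" for \<mu>
      proof -
        have "(\<Sum>\<nu>\<in>L. ?t \<mu> \<nu>) = (\<Sum>\<nu>\<in>{\<mu>}. ?t \<mu> \<nu>)"
          using that True 2 by (intro sum.mono_neutral_right) auto
        also have "\<dots> = (-1) ^ (card K - 1) * (shuffle_sign {\<mu>} (K - {\<mu>}) * shuffle_sign {\<mu>} (K - {\<mu>}))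
            * (\<i> / 2 * a \<mu>) * (diag_sign (card (K - {\<mu>})) * w (K - {\<mu>}))"
          using that True by (auto simp: diag_form_def)
        also have "\<dots> = diag_sign (card K) * (a \<mu> * w (K - {\<mu>}))"
        proof -
          have m: "card K = Suc (card (K - {\<mu>}))"
            by (rule card_Suc_Diff1[symmetric]) (use that 2 in auto)
          show ?thesis
            unfolding m shuffle_sign_square diag_sign_Suc by simp
        qed
        finally show ?thesis .
      qed
      then have "wedge ?A (diag_form n w) K L = (\<Sum>\<mu>\<in>K. diag_sign (card K) * (a \<mu> * w (K - {\<mu>})))"
        unfolding eq by (rule sum.cong[OF refl])
      also have "\<dots> = ?D K L"
        using True by (auto simp: diag_form_def sum_distrib_left)
      finally show ?thesis .
    qed
  qed
qed

abbreviation std_form :: "nat \<Rightarrow> form" where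
  "std_form n \<equiv> form11 n (\<lambda>\<mu> \<nu>. if \<mu> = \<nu> then 1 else 0)"

text \<open>Each further factor removes one element of the index set by \<open>wedge_diag\<close>;
  the factorial counts the orders in which the elements can be removed.\<close>

lemma form_pow_std_form:
  "form_pow (std_form n) m = diag_form n (\<lambda>I. if card I = m then fact m else 0)"
proof (induction m)
  case 0
  show ?case
    by (auto simp: form_pow_def form_one_def diag_form_def diag_sign_def fun_eq_iff
        dest: finite_subset[OF _ finite_lessThan])
next
  case (Suc m)
  have "form_pow (std_form n) (Suc m) = wedge (std_form n) (form_pow (std_form n) m)"
    by (simp add: form_pow_def)
  also have "\<dots> = diag_form n (\<lambda>K. \<Sum>\<mu>\<in>K. 1 * (if card (K - {\<mu>}) = m then fact m else 0))"
    unfolding Suc by (rule wedge_diag)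
  also have "\<dots> = diag_form n (\<lambda>I. if card I = Suc m then fact (Suc m) else 0)"
  proof (intro ext)
    fix I J :: "nat set"
    have "(\<Sum>\<mu>\<in>I. if card (I - {\<mu>}) = m then fact m else 0)
        = (if card I = Suc m then fact (Suc m) else (0::complex))" if "finite I" for I :: "nat set"
    proof -
      have "(\<Sum>\<mu>\<in>I. if card (I - {\<mu>}) = m then fact m else 0)
          = (\<Sum>\<mu>\<in>I. if card I = Suc m then fact m else (0::complex))"
        using that by (intro sum.cong refl) (metis card_Suc_Diff1 nat.inject)
      also have "\<dots> = (if card I = Suc m then fact (Suc m) else 0)"
        by (cases "card I = Suc m") simp_all
      finally show ?thesis .
    qed
    then show "diag_form n (\<lambda>K. \<Sum>\<mu>\<in>K. 1 * (if card (K - {\<mu>}) = m then fact m else 0)) I J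
      = diag_form n (\<lambda>I. if card I = Suc m then fact (Suc m) else 0) I J"
      by (auto simp: diag_form_def dest: finite_subset[OF _ finite_lessThan])
  qed
  finally show ?case .
qed

section \<open>Support of forms and basic rules for wedge products\<close>

lemma formsD:
  assumes "\<alpha> \<in> forms n p q" "\<alpha> I J \<noteq> 0"
  shows "I \<subseteq> {..<n}" "J \<subseteq> {..<n}" "card I = p" "card J = q"
  using assms unfolding forms_def mem_Collect_eq by blast+

lemma formsI:
  assumes "\<And>I J. \<not> (I \<subseteq> {..<n} \<and> J \<subseteq> {..<n} \<and> card I = p \<and> card J = q) \<Longrightarrow> \<alpha> I J = 0"
  shows "\<alpha> \<in> forms n p q"
  unfolding forms_def mem_Collect_eq
proof (intro allI impI)
  fix I J assume "\<alpha> I J \<noteq> 0"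
  then show "I \<subseteq> {..<n} \<and> J \<subseteq> {..<n} \<and> card I = p \<and> card J = q"
    by (rule contrapos_np) (rule assms)
qed

lemma wedge_form_one:
  assumes "\<alpha> \<in> forms n p q"
  shows "wedge \<alpha> form_one = \<alpha>"
proof (intro ext)
  fix K L
  show "wedge \<alpha> form_one K L = \<alpha> K L"
  proof (cases "finite K \<and> finite L")
    \<comment> \<open>On infinite index sets \<open>wedge\<close> is 0 because it sums over an
      infinite set, and \<open>\<alpha>\<close> is 0 because its support lies in
      \<open>{..<n}\<close>.\<close>
    case False
    then have "\<not> (K \<subseteq> {..<n} \<and> L \<subseteq> {..<n})"
      by (meson finite_lessThan finite_subset)
    then have "\<alpha> K L = 0"
      using formsD[OF assms] by blast
    with False show ?thesis by (simp add: wedge_infinite)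
  next
    case True
    let ?t = "\<lambda>I J. (-1) ^ (card J * card (K - I)) * shuffle_sign I (K - I)
        * shuffle_sign J (L - J) * \<alpha> I J * form_one (K - I) (L - J)"
    have "wedge \<alpha> form_one K L = (\<Sum>I\<in>{K}. \<Sum>J\<in>Pow L. ?t I J)"
      unfolding wedge_def
    proof (rule sum.mono_neutral_right)
      show "\<forall>I\<in>Pow K - {K}. (\<Sum>J\<in>Pow L. ?t I J) = 0"
        by (intro ballI sum.neutral) (auto simp: form_one_def)
    qed (use True in auto)
    also have "\<dots> = (\<Sum>J\<in>Pow L. ?t K J)"
      by simp
    also have "\<dots> = (\<Sum>J\<in>{L}. ?t K J)"
    proof (rule sum.mono_neutral_right)
      show "\<forall>J\<in>Pow L - {L}. ?t K J = 0"
        by (auto simp: form_one_def)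
    qed (use True in auto)
    also have "\<dots> = \<alpha> K L"
      by (simp add: form_one_def shuffle_sign_def)
    finally show ?thesis .
  qed
qed

lemma wedge_add_right:
  "wedge \<alpha> (\<lambda>I J. \<beta> I J + \<gamma> I J) = (\<lambda>K L. wedge \<alpha> \<beta> K L + wedge \<alpha> \<gamma> K L)"
  by (simp add: wedge_def algebra_simps sum.distrib)

lemma foldr_wedge_zero:
  "(\<lambda>_ _. 0) \<in> set \<alpha>s \<Longrightarrow> foldr wedge \<alpha>s \<beta> = (\<lambda>_ _. 0)"
  by (induction \<alpha>s) (auto simp: wedge_zero_left wedge_zero_right)

lemma foldr_wedge_const:
  assumes "set \<alpha>s \<subseteq> {\<omega>}"
  shows "foldr wedge \<alpha>s form_one = form_pow \<omega> (length \<alpha>s)"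
  using assms by (induction \<alpha>s) (simp_all add: form_pow_def)

section \<open>The determinant\<close>

text \<open>In the rows from 2 on only the diagonal entry is nonzero, so a permutation contributes
  only if it fixes every index from 2 on. This leaves the identity and the transposition of 0 and
  1.\<close>

lemma form_det_block:
  assumes "2 \<le> k"
    and diag: "\<And>a. 2 \<le> a \<Longrightarrow> a < k \<Longrightarrow> M a a = \<omega>"
    and off: "\<And>a b. 2 \<le> a \<Longrightarrow> a < k \<Longrightarrow> b \<noteq> a \<Longrightarrow> M a b = (\<lambda>_ _. 0)"
  shows "form_det k M = (\<lambda>I J. wedge (M 0 0) (wedge (M 1 1) (form_pow \<omega> (k - 2))) I J
           - wedge (M 0 1) (wedge (M 1 0) (form_pow \<omega> (k - 2))) I J)"
proof (intro ext)
  fix I J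
  let ?F = "\<lambda>\<sigma>. foldr wedge (map (\<lambda>a. M a (\<sigma> a)) [0..<k]) form_one"
  let ?s = "Transposition.transpose (0::nat) 1"
  have sub: "{id, ?s} \<subseteq> {\<sigma>. \<sigma> permutes {..<k}}"
    using assms(1) by (auto intro: permutes_id permutes_swap_id)
  have zero: "?F \<sigma> = (\<lambda>_ _. 0)" if "\<sigma> permutes {..<k}" "\<sigma> \<noteq> id" "\<sigma> \<noteq> ?s" for \<sigma>
  proof -
    have "\<exists>a\<ge>2. a < k \<and> \<sigma> a \<noteq> a"
    proof (rule ccontr)
      assume "\<not> ?thesis"
      then have "\<sigma> x = x" if "x \<notin> {0, 1}" for x
        using that \<open>\<sigma> permutes {..<k}\<close> by (cases "x < k") (auto simp: permutes_def)
      then have "\<sigma> permutes {0, 1}"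
        using \<open>\<sigma> permutes {..<k}\<close> by (auto simp: permutes_def)
      then show False
        using that by (auto simp: permutes_doubleton_iff)
    qed
    then obtain a where "2 \<le> a" "a < k" "\<sigma> a \<noteq> a" by blast
    then have "(\<lambda>_ _. 0) = M a (\<sigma> a)" "a \<in> set [0..<k]"
      using off by auto
    then show ?thesis
      by (intro foldr_wedge_zero) (simp only: set_map image_eqI)
  qed
  have "[0..<k] = 0 # 1 # [2..<k]"
    using assms(1) by (simp add: upt_conv_Cons numeral_2_eq_2)
  then have F: "?F \<sigma> = wedge (M 0 (\<sigma> 0)) (wedge (M 1 (\<sigma> 1)) (form_pow \<omega> (k - 2)))"
    if "\<And>a. 2 \<le> a \<Longrightarrow> \<sigma> a = a" for \<sigma>
  proof -
    have "foldr wedge (map (\<lambda>a. M a (\<sigma> a)) [2..<k]) form_one = form_pow \<omega> (k - 2)"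
      using diag that by (subst foldr_wedge_const[where \<omega> = \<omega>]) auto
    with \<open>[0..<k] = 0 # 1 # [2..<k]\<close> show ?thesis by simp
  qed
  have "form_det k M I J = (\<Sum>\<sigma>\<in>{id, ?s}. of_int (sign \<sigma>) * ?F \<sigma> I J)"
    unfolding form_det_def using sub zero
    by (intro sum.mono_neutral_right finite_permutations) auto
  also have "\<dots> = ?F id I J - ?F ?s I J"
  proof -
    have "id \<noteq> ?s" by (metis id_apply transpose_apply_first zero_neq_one)
    then show ?thesis by (simp add: sign_swap_id sign_id)
  qed
  also have "?F id = wedge (M 0 0) (wedge (M 1 1) (form_pow \<omega> (k - 2)))"
    by (subst F) simp_all
  also have "?F ?s = wedge (M 0 1) (wedge (M 1 0) (form_pow \<omega> (k - 2)))"
    by (subst F) (simp_all add: Transposition.transpose_def)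
  finally show "form_det k M I J = wedge (M 0 0) (wedge (M 1 1) (form_pow \<omega> (k - 2))) I J
           - wedge (M 0 1) (wedge (M 1 0) (form_pow \<omega> (k - 2))) I J" .
qed

section \<open>Products of off-diagonal elementary forms\<close>

abbreviation elem_form :: "nat \<Rightarrow> nat \<Rightarrow> nat \<Rightarrow> complex \<Rightarrow> form" where
  "elem_form n i j c \<equiv> form11 n (\<lambda>\<mu> \<nu>. if \<mu> = i \<and> \<nu> = j then c else 0)"

lemma wedge_elem_form:
  assumes "finite K" "finite L" "i < n" "j < n"
  shows "wedge (elem_form n i j c) \<beta> K L = (if i \<in> K \<and> j \<in> L then
     (-1) ^ (card K - 1) * shuffle_sign {i} (K - {i}) * shuffle_sign {j} (L - {j})
       * (\<i> / 2 * c) * \<beta> (K - {i}) (L - {j}) else 0)"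
proof -
  let ?t = "(-1) ^ (card K - 1) * shuffle_sign {i} (K - {i}) * shuffle_sign {j} (L - {j})
       * (\<i> / 2 * c) * \<beta> (K - {i}) (L - {j})"
  have "wedge (elem_form n i j c) \<beta> K L
      = (\<Sum>\<mu>\<in>K. \<Sum>\<nu>\<in>L. if \<mu> = i then if \<nu> = j then ?t else 0 else 0)"
    unfolding wedge_form11[OF assms(1,2)] using assms(3,4) by (intro sum.cong refl) auto
  also have "\<dots> = (\<Sum>\<mu>\<in>K. if \<mu> = i then if j \<in> L then ?t else 0 else 0)"
    using assms(1,2) by (intro sum.cong refl) simp
  also have "\<dots> = (if i \<in> K \<and> j \<in> L then ?t else 0)"
    using assms(1,2) by simp
  finally show ?thesis .
qed

text \<open>The sign counts the elements of \<open>K\<close> below \<open>i\<close>, and deleting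
  \<open>j\<close> changes this count exactly when j < i.\<close>

lemma shuffle_sign_remove:
  assumes "finite K" "j \<in> K" "i \<noteq> j"
  shows "shuffle_sign {i} (K - {i}) = (if j < i then -1 else 1) * shuffle_sign {i} (K - {j} - {i})"
proof -
  have 1: "{x \<in> K - {i}. x < i} = {x \<in> K. x < i}" "{x \<in> K - {j} - {i}. x < i} = {x \<in> K. x < i} - {j}"
    by auto
  show ?thesis
  proof (cases "j < i")
    case True
    then have "card {x \<in> K. x < i} = Suc (card ({x \<in> K. x < i} - {j}))"
      using assms by (intro card_Suc_Diff1[symmetric]) auto
    with True show ?thesis by (simp only: shuffle_sign_singleton 1) simp
  next
    case False
    then have "{x \<in> K. x < i} - {j} = {x \<in> K. x < i}" by auto
    with False show ?thesis by (simp only: shuffle_sign_singleton 1) simp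
  qed
qed

text \<open>Of i < j and j < i exactly one holds, so by \<open>shuffle_sign_remove\<close> exactly
  one of the two signs flips; all other factors occur twice and cancel.\<close>

lemma shuffle_sign_swap:
  assumes "finite K" "i \<in> K" "j \<in> K" "i \<noteq> j"
  shows "shuffle_sign {i} (K - {i}) * shuffle_sign {j} (K - {j})
     * (shuffle_sign {j} (K - {i} - {j}) * shuffle_sign {i} (K - {j} - {i})) = -1"
proof -
  let ?a = "shuffle_sign {i} (K - {j} - {i})" and ?b = "shuffle_sign {j} (K - {i} - {j})"
  have "shuffle_sign {i} (K - {i}) * shuffle_sign {j} (K - {j}) = - (?a * ?b)"
    using shuffle_sign_remove[OF assms(1,3,4)] shuffle_sign_remove[OF assms(1,2), of j] assms(4)
    by (cases "i < j") auto
  then have "shuffle_sign {i} (K - {i}) * shuffle_sign {j} (K - {j}) * (?b * ?a)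
      = - ((?a * ?a) * (?b * ?b))"
    by simp
  then show ?thesis
    by (simp only: shuffle_sign_square mult_1_left)
qed

text \<open>The two factors together supply both differentials with index \<open>i\<close> and both
  with index \<open>j\<close>, so the product is diagonal again. The minus sign is the one from
  \<open>shuffle_sign_swap\<close>; in the determinant it cancels the sign of the
  transposition.\<close>

lemma wedge_elem_form_swap:
  assumes "i < n" "j < n" "i \<noteq> j"
  shows "wedge (elem_form n i j c) (wedge (elem_form n j i d) (diag_form n w))
    = diag_form n (\<lambda>K. if i \<in> K \<and> j \<in> K then - (c * d * w (K - {i, j})) else 0)"
proof (intro ext)
  fix K L
  let ?l = "wedge (elem_form n i j c) (wedge (elem_form n j i d) (diag_form n w))"
  let ?D = "diag_form n (\<lambda>K. if i \<in> K \<and> j \<in> K then - (c * d * w (K - {i, j})) else 0)"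
  show "?l K L = ?D K L"
  proof (cases "finite K \<and> finite L")
    case False
    then have "?D K L = 0"
      by (auto simp: diag_form_def dest: finite_subset[OF _ finite_lessThan])
    with False show ?thesis by (simp add: wedge_infinite)
  next
    case True
    then have fin: "finite K" "finite L" "finite (K - {i})" "finite (L - {j})" by auto
    show ?thesis
    proof (cases "i \<in> K \<and> j \<in> K \<and> K = L \<and> K \<subseteq> {..<n}")
      case False
      then have "?D K L = 0" by (auto simp: diag_form_def)
      moreover have "?l K L = 0"
      proof (rule ccontr)
        assume "?l K L \<noteq> 0"
        then have "i \<in> K" "j \<in> L" "j \<in> K - {i}" "i \<in> L - {j}"
          and "diag_form n w (K - {i} - {j}) (L - {j} - {i}) \<noteq> 0"
          using assms by (auto simp: wedge_elem_form fin split: if_splits)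
        moreover from this(5) have "K - {i} - {j} = L - {j} - {i}" "K - {i} - {j} \<subseteq> {..<n}"
          by (auto simp: diag_form_def split: if_splits)
        ultimately have "i \<in> K \<and> j \<in> K \<and> K = L \<and> K \<subseteq> {..<n}"
          using assms by blast
        with False show False ..
      qed
      ultimately show ?thesis by simp
    next
      case True
      then have [simp]: "L = K" and ij: "i \<in> K" "j \<in> K" and K: "K \<subseteq> {..<n}" by auto
      define m where "m = card (K - {i} - {j})"
      have "card K = Suc (card (K - {i}))"
        using fin ij by (intro card_Suc_Diff1[symmetric])
      moreover have "card (K - {i}) = Suc (card (K - {i} - {j}))"
        using fin ij assms by (intro card_Suc_Diff1[symmetric]) auto
      ultimately have card: "card K = Suc (Suc m)" "card (K - {i}) = Suc m"
        by (simp_all add: m_def)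
      have eqs: "K - {j} - {i} = K - {i} - {j}" "K - {i, j} = K - {i} - {j}" by auto
      have "K - {i} - {j} \<subseteq> {..<n}" using K by auto
      then have dw: "diag_form n w (K - {i} - {j}) (K - {i} - {j}) = diag_sign m * w (K - {i} - {j})"
        by (simp add: diag_form_def m_def)
      have "?l K L = (-1) ^ (card K - 1) * (-1) ^ (card (K - {i}) - 1)
          * (shuffle_sign {i} (K - {i}) * shuffle_sign {j} (K - {j})
             * (shuffle_sign {j} (K - {i} - {j}) * shuffle_sign {i} (K - {j} - {i})))
          * (\<i> / 2 * c) * (\<i> / 2 * d) * diag_form n w (K - {i} - {j}) (K - {i} - {j})"
        using assms ij by (simp add: wedge_elem_form fin fin[simplified] eqs)
      also have "\<dots> = - (diag_sign (card K) * (c * d * w (K - {i, j})))"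
        unfolding shuffle_sign_swap[OF fin(1) ij assms(3)] unfolding dw eqs card diag_sign_Suc
        by (simp add: field_simps)
      also have "\<dots> = ?D K L"
        using ij K by (simp add: diag_form_def)
      finally show ?thesis .
    qed
  qed
qed

text \<open>The two elementary factors supply the holomorphic indices i, i' and the conjugate
  indices j, j', while the remaining factor has equal index sets. This locates the cross terms of
  the determinant.\<close>

lemma wedge_elem_form_cross:
  assumes "i < n" "j < n" "i' < n" "j' < n" "{i, i'} \<inter> {j, j'} = {}"
    and nz: "wedge (elem_form n i j c) (wedge (elem_form n i' j' d) (diag_form n w)) K L \<noteq> 0"
  shows "{i, i'} \<subseteq> K" "{j, j'} \<subseteq> L" "K \<noteq> L"
proof -
  have fin: "finite K" "finite L"
    using nz wedge_infinite by blast+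
  then have *: "i \<in> K" "j \<in> L" "i' \<in> K - {i}" "j' \<in> L - {j}"
     "diag_form n w (K - {i} - {i'}) (L - {j} - {j'}) \<noteq> 0"
    using nz assms(1-4) by (auto simp: wedge_elem_form split: if_splits)
  from *(5) have "K - {i} - {i'} = L - {j} - {j'}"
    by (auto simp: diag_form_def split: if_splits)
  with * assms(5) show "{i, i'} \<subseteq> K" "{j, j'} \<subseteq> L" "K \<noteq> L"
    by auto
qed

lemma form11_add: "form11 n (\<lambda>\<mu> \<nu>. A \<mu> \<nu> + B \<mu> \<nu>) = (\<lambda>I J. form11 n A I J + form11 n B I J)"
  by (auto simp: form11_def fun_eq_iff algebra_simps)

section \<open>The matrix and the coefficients of its determinant\<close>

definition coupling :: "real \<Rightarrow> real \<Rightarrow> nat \<Rightarrow> nat \<Rightarrow> nat \<Rightarrow> nat \<Rightarrow> complex" where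
  "coupling p T a b \<mu> \<nu> =
    (if a = b then if \<mu> = \<nu> then 1 + of_real T * of_bool (a = 1 \<and> (\<mu> = 1 \<or> \<mu> = 3)) else 0
     else if a = 0 \<and> b = 1 \<and> (\<mu> = 0 \<and> \<nu> = 1 \<or> \<mu> = 2 \<and> \<nu> = 3)
          \<or> a = 1 \<and> b = 0 \<and> (\<mu> = 1 \<and> \<nu> = 0 \<or> \<mu> = 3 \<and> \<nu> = 2) then of_real p else 0)"

definition coupling_matrix :: "nat \<Rightarrow> real \<Rightarrow> real \<Rightarrow> nat \<Rightarrow> nat \<Rightarrow> form" where
  "coupling_matrix n p T a b = form11 n (coupling p T a b)"

lemma coupling_cnj: "cnj (coupling p T b a \<nu> \<mu>) = coupling p T a b \<mu> \<nu>"
  by (auto simp: coupling_def)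

lemma herm_matrix_coupling: "herm_matrix n k (coupling_matrix n p T)"
  by (auto simp: herm_matrix_def coupling_matrix_def form11_in_forms form_cnj_form11 coupling_cnj
      simp del: One_nat_def)

text \<open>The weight of e_K in the diagonal part of the determinant: once e_1 or e_3 is split off,
  the rest of \<open>K\<close> arises in (k - 1)! orders from the power of the standard form, and
  once e_0 e_1 or e_2 e_3 is split off, in (k - 2)! orders.\<close>

definition det_coeff :: "real \<Rightarrow> real \<Rightarrow> nat \<Rightarrow> nat set \<Rightarrow> complex" where
  "det_coeff p T k K = (if card K = k then fact k
     + of_real T * fact (k - 1) * (of_bool (1 \<in> K) + of_bool (3 \<in> K))
     + of_real (p\<^sup>2) * fact (k - 2) * (of_bool (0 \<in> K \<and> 1 \<in> K) + of_bool (2 \<in> K \<and> 3 \<in> K)) else 0)"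

lemma sum_if_card_remove:
  fixes b :: "nat \<Rightarrow> complex"
  assumes "finite S"
  shows "(\<Sum>\<nu>\<in>S. b \<nu> * (if card (S - {\<nu>}) = m then c \<nu> else 0))
    = (if card S = Suc m then \<Sum>\<nu>\<in>S. b \<nu> * c \<nu> else 0)"
proof -
  have "card S = Suc (card (S - {\<nu>}))" if "\<nu> \<in> S" for \<nu>
    using card_Suc_Diff1[OF assms that] by simp
  then have "(\<Sum>\<nu>\<in>S. b \<nu> * (if card (S - {\<nu>}) = m then c \<nu> else 0))
     = (\<Sum>\<nu>\<in>S. if card S = Suc m then b \<nu> * c \<nu> else 0)"
    by (intro sum.cong refl) auto
  then show ?thesis by auto
qed

lemma diag_form_cong:
  assumes "\<And>K. finite K \<Longrightarrow> v K = w K"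
  shows "diag_form n v = diag_form n w"
  using assms by (auto simp: diag_form_def fun_eq_iff dest: finite_subset[OF _ finite_lessThan])

lemma wedge_coupling_diag:
  "wedge (coupling_matrix n p T 0 0) (wedge (coupling_matrix n p T 1 1) (form_pow (std_form n) m))
    = diag_form n (\<lambda>K. if card K = m + 2 then fact (m + 2)
        + of_real T * fact (m + 1) * (of_bool (1 \<in> K) + of_bool (3 \<in> K)) else 0)"
proof -
  define b :: "nat \<Rightarrow> complex" where "b \<nu> = 1 + of_real T * of_bool (\<nu> = 1 \<or> \<nu> = 3)" for \<nu>
  define e :: "nat set \<Rightarrow> complex" where "e S = of_bool (1 \<in> S) + of_bool (3 \<in> S)" for S
  have M: "coupling_matrix n p T 0 0 = form11 n (\<lambda>\<mu> \<nu>. if \<mu> = \<nu> then 1 else 0)"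
      "coupling_matrix n p T 1 1 = form11 n (\<lambda>\<mu> \<nu>. if \<mu> = \<nu> then b \<mu> else 0)"
    unfolding coupling_matrix_def
    by (rule arg_cong[where f = "form11 n"], simp add: coupling_def b_def fun_eq_iff)+
  have sum_e: "(\<Sum>\<nu>\<in>S. of_bool (\<nu> = 1 \<or> \<nu> = 3)) = e S" if "finite S" for S
  proof -
    have "(\<Sum>\<nu>\<in>S. of_bool (\<nu> = 1 \<or> \<nu> = 3) :: complex)
        = (\<Sum>\<nu>\<in>S. (if \<nu> = 1 then 1 else 0) + (if \<nu> = 3 then 1 else 0))"
      by (intro sum.cong) auto
    then show ?thesis using that by (simp add: sum.distrib e_def)
  qed
  have inner: "(\<Sum>\<nu>\<in>S. b \<nu> * (if card (S - {\<nu>}) = m then fact m else 0))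
      = (if card S = Suc m then fact m * (of_nat (Suc m) + of_real T * e S) else 0)"
    if "finite S" for S
  proof -
    have "(\<Sum>\<nu>\<in>S. b \<nu> * fact m) = fact m * (of_nat (card S) + of_real T * e S)"
      unfolding sum_distrib_right[symmetric] b_def sum.distrib sum_distrib_left[symmetric] sum_e[OF that]
      by simp
    then show ?thesis
      unfolding sum_if_card_remove[OF that] by auto
  qed
  \<comment> \<open>Each of 1 and 3, if it lies in \<open>K\<close>, is lost for exactly one of the
    m + 2 choices of \<mu>, so it is counted m + 1 times.\<close>
  have outer: "(\<Sum>\<mu>\<in>K. of_nat (Suc m) + of_real T * e (K - {\<mu>}))
      = of_nat (m + 2) * of_nat (Suc m) + of_real T * (of_nat (Suc m) * e K)"
    if "finite K" "card K = m + 2" for K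
  proof -
    have "e (K - {\<mu>}) = e K - of_bool (\<mu> = 1 \<or> \<mu> = 3)" if "\<mu> \<in> K" for \<mu>
      using that by (auto simp: e_def)
    then have "(\<Sum>\<mu>\<in>K. e (K - {\<mu>})) = (\<Sum>\<mu>\<in>K. e K - of_bool (\<mu> = 1 \<or> \<mu> = 3))"
      by (intro sum.cong) auto
    also have "\<dots> = of_nat (Suc m) * e K"
      unfolding sum_subtractf sum_e[OF that(1)] using that(2) by (simp add: algebra_simps)
    finally show ?thesis
      using that by (simp add: sum.distrib flip: sum_distrib_left)
  qed
  show ?thesis
    unfolding M form_pow_std_form wedge_diag
  proof (rule diag_form_cong)
    fix K :: "nat set"
    assume K: "finite K"
    have "(\<Sum>\<mu>\<in>K. 1 * (\<Sum>\<nu>\<in>K - {\<mu>}. b \<nu> * (if card (K - {\<mu>} - {\<nu>}) = m then fact m else 0)))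
        = (\<Sum>\<mu>\<in>K. 1 * (if card (K - {\<mu>}) = Suc m
             then fact m * (of_nat (Suc m) + of_real T * e (K - {\<mu>})) else 0))"
      using K by (intro sum.cong refl arg_cong2[where f = "(*)"] inner) auto
    also have "\<dots> = (if card K = m + 2
        then fact m * (\<Sum>\<mu>\<in>K. of_nat (Suc m) + of_real T * e (K - {\<mu>})) else 0)"
      using K by (subst sum_if_card_remove) (simp_all add: sum_distrib_left)
    also have "\<dots> = (if card K = m + 2 then fact (m + 2) + of_real T * fact (m + 1) * e K else 0)"
      using outer[OF K] by (auto simp: algebra_simps)
    finally show "(\<Sum>\<mu>\<in>K. 1 * (\<Sum>\<nu>\<in>K - {\<mu>}. b \<nu> * (if card (K - {\<mu>} - {\<nu>}) = m then fact m else 0)))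
       = (if card K = m + 2 then fact (m + 2)
        + of_real T * fact (m + 1) * (of_bool (1 \<in> K) + of_bool (3 \<in> K)) else 0)"
      by (simp only: e_def)
  qed
qed

text \<open>Each off-diagonal entry is a sum of two elementary forms. Of the four products, the two
  that pair an elementary form with its conjugate are diagonal by
  \<open>wedge_elem_form_swap\<close>; the two mixed ones form the remainder \<open>R\<close>,
  controlled by \<open>wedge_elem_form_cross\<close>.\<close>

lemma wedge_coupling_off_diag:
  assumes "4 \<le> n"
  obtains R where
    "wedge (coupling_matrix n p T 0 1) (wedge (coupling_matrix n p T 1 0) (form_pow (std_form n) m))
       = (\<lambda>I J. diag_form n (\<lambda>K. if card K = m + 2 then - (of_real (p\<^sup>2) * fact m
            * (of_bool (0 \<in> K \<and> 1 \<in> K) + of_bool (2 \<in> K \<and> 3 \<in> K))) else 0) I J + R I J)"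
    and "\<And>I J. R I J \<noteq> 0 \<Longrightarrow> {0, 1, 2, 3} \<subseteq> I \<union> J"
proof -
  let ?w = "\<lambda>I. if card I = m then fact m else 0 :: complex"
  let ?W = "diag_form n ?w"
  let ?p = "of_real p :: complex"
  let ?E = "\<lambda>i j. elem_form n i j ?p"
  let ?V = "\<lambda>i j i' j'. wedge (?E i j) (wedge (?E i' j') ?W)"
  let ?d = "\<lambda>i j K. if i \<in> K \<and> j \<in> K then - (?p * ?p * ?w (K - {i, j})) else 0"
  define R where "R I J = ?V 0 1 3 2 I J + ?V 2 3 1 0 I J" for I J
  have M: "coupling_matrix n p T 0 1 = (\<lambda>I J. ?E 0 1 I J + ?E 2 3 I J)"
    "coupling_matrix n p T 1 0 = (\<lambda>I J. ?E 1 0 I J + ?E 3 2 I J)"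
    unfolding coupling_matrix_def form11_add[symmetric]
    by (rule arg_cong[where f = "form11 n"], force simp: coupling_def fun_eq_iff)+
  have card: "card K = Suc (Suc (card (K - {i, j})))"
    if "finite K" "i \<in> K" "j \<in> K" "i \<noteq> j" for K and i j :: nat
  proof -
    have "card (K - {i}) = Suc (card (K - {i} - {j}))" "card K = Suc (card (K - {i}))"
      using that by (intro card_Suc_Diff1[symmetric]; simp)+
    moreover have "K - {i} - {j} = K - {i, j}" by auto
    ultimately show ?thesis by simp
  qed
  have "wedge (coupling_matrix n p T 0 1) (wedge (coupling_matrix n p T 1 0) (form_pow (std_form n) m))
      = (\<lambda>I J. ?V 0 1 1 0 I J + ?V 2 3 3 2 I J + R I J)"
    unfolding M form_pow_std_form wedge_add_left wedge_add_right R_def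
    by (simp add: algebra_simps)
  also have "\<dots> = (\<lambda>I J. diag_form n (?d 0 1) I J + diag_form n (?d 2 3) I J + R I J)"
    using assms by (simp add: wedge_elem_form_swap del: One_nat_def)
  also have "\<dots> = (\<lambda>I J. diag_form n (\<lambda>K. ?d 0 1 K + ?d 2 3 K) I J + R I J)"
    by (auto simp: diag_form_def algebra_simps fun_eq_iff)
  also have "diag_form n (\<lambda>K. ?d 0 1 K + ?d 2 3 K) = diag_form n (\<lambda>K. if card K = m + 2 then - (of_real (p\<^sup>2) * fact m
            * (of_bool (0 \<in> K \<and> 1 \<in> K) + of_bool (2 \<in> K \<and> 3 \<in> K))) else 0)"
  proof (rule diag_form_cong)
    fix K :: "nat set" assume K: "finite K"
    have "?d i j K = (if card K = m + 2 then - (of_real (p\<^sup>2) * fact m * of_bool (i \<in> K \<and> j \<in> K)) else 0)"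
      if "i \<noteq> j" for i j
      using card[OF K, of i j] that by (auto simp: power2_eq_square)
    from this[of 0 1] this[of 2 3]
    show "?d 0 1 K + ?d 2 3 K = (if card K = m + 2 then - (of_real (p\<^sup>2) * fact m
            * (of_bool (0 \<in> K \<and> 1 \<in> K) + of_bool (2 \<in> K \<and> 3 \<in> K))) else 0)"
      by (simp add: algebra_simps)
  qed
  finally show ?thesis
  proof (rule that)
    fix I J assume "R I J \<noteq> 0"
    then have "?V 0 1 3 2 I J \<noteq> 0 \<or> ?V 2 3 1 0 I J \<noteq> 0"
      by (auto simp: R_def)
    then show "{0, 1, 2, 3} \<subseteq> I \<union> J"
      using wedge_elem_form_cross(1,2)[of 0 n 1 3 2 ?p ?p ?w I J]
        wedge_elem_form_cross(1,2)[of 2 n 3 1 0 ?p ?p ?w I J] assms by auto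
  qed
qed

lemma form_det_coupling:
  assumes "4 \<le> n" "2 \<le> k"
  obtains R where
    "form_det k (coupling_matrix n p T) = (\<lambda>I J. diag_form n (det_coeff p T k) I J + R I J)"
    and "\<And>I J. R I J \<noteq> 0 \<Longrightarrow> {0, 1, 2, 3} \<subseteq> I \<union> J"
proof -
  obtain m where k: "k = m + 2"
    using assms(2) by (metis add.commute le_Suc_ex)
  obtain R where R: "wedge (coupling_matrix n p T 0 1) (wedge (coupling_matrix n p T 1 0) (form_pow (std_form n) m))
       = (\<lambda>I J. diag_form n (\<lambda>K. if card K = m + 2 then - (of_real (p\<^sup>2) * fact m
            * (of_bool (0 \<in> K \<and> 1 \<in> K) + of_bool (2 \<in> K \<and> 3 \<in> K))) else 0) I J + R I J)"
    and R0: "\<And>I J. R I J \<noteq> 0 \<Longrightarrow> {0, 1, 2, 3} \<subseteq> I \<union> J"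
    using wedge_coupling_off_diag[OF assms(1)] by blast
  have "form_det k (coupling_matrix n p T) = (\<lambda>I J.
      wedge (coupling_matrix n p T 0 0) (wedge (coupling_matrix n p T 1 1) (form_pow (std_form n) m)) I J
    - wedge (coupling_matrix n p T 0 1) (wedge (coupling_matrix n p T 1 0) (form_pow (std_form n) m)) I J)"
    by (subst form_det_block[OF assms(2), where \<omega> = "std_form n"])
      (auto simp: coupling_matrix_def coupling_def k form11_def fun_eq_iff)
  \<comment> \<open>The determinant subtracts the off-diagonal product, which turns its weight -p^2
    into +p^2 and its remainder \<open>R\<close> into \<open>- R\<close>.\<close>
  also have "\<dots> = (\<lambda>I J. diag_form n (det_coeff p T k) I J + - R I J)"
    unfolding wedge_coupling_diag R
    by (auto simp: diag_form_def det_coeff_def k algebra_simps fun_eq_iff)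
  finally show ?thesis
    using that[of "\<lambda>I J. - R I J"] R0 by auto
qed

section \<open>Positivity\<close>

text \<open>Griffiths positivity is Nakano positivity tested on the decomposable tensors
  \<open>\<theta> a * u \<mu>\<close> only; such a tensor is nonzero if both factors are.\<close>

lemma nakano_imp_griffiths:
  assumes "nakano_positive n k M"
  shows "griffiths_positive n k M"
  unfolding griffiths_positive_def
proof (intro conjI allI impI)
  have herm: "herm_matrix n k M" using assms by (simp add: nakano_positive_def)
  then show "herm_matrix n k M" .
  have hermD: "M a b \<in> forms n 1 1" "form_cnj (M a b) = M b a" if "a < k" "b < k" for a b
    using herm[unfolded herm_matrix_def, rule_format, OF that] by (rule conjunct1, intro sym[OF conjunct2])
  fix \<theta> :: "nat \<Rightarrow> complex"
  assume "\<exists>a<k. \<theta> a \<noteq> 0"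
  then obtain a where a: "a < k" "\<theta> a \<noteq> 0" by blast
  let ?\<alpha> = "\<lambda>I J. \<Sum>a<k. \<Sum>b<k. \<theta> a * cnj (\<theta> b) * M a b I J"
  have M0: "M a b I J = 0" if "a < k" "b < k"
    "\<not> (I \<subseteq> {..<n} \<and> J \<subseteq> {..<n} \<and> card I = 1 \<and> card J = 1)" for a b I J
  proof (rule ccontr)
    assume nz: "M a b I J \<noteq> 0"
    show False using formsD[OF hermD(1)[OF that(1,2)] nz] that(3) by simp
  qed
  have "?\<alpha> \<in> forms n 1 1"
  proof (rule formsI)
    fix I J assume "\<not> (I \<subseteq> {..<n} \<and> J \<subseteq> {..<n} \<and> card I = 1 \<and> card J = 1)"
    from M0[OF _ _ this] show "?\<alpha> I J = 0"
      by (intro sum.neutral ballI) (simp only: lessThan_iff mult_zero_right)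
  qed
  moreover have "form_cnj ?\<alpha> = ?\<alpha>"
  proof (intro ext)
    fix I J
    have "form_cnj ?\<alpha> I J = (\<Sum>a<k. \<Sum>b<k. cnj (\<theta> a) * \<theta> b * form_cnj (M a b) I J)"
      by (simp add: form_cnj_def sum_distrib_left mult_ac)
    also have "\<dots> = (\<Sum>a<k. \<Sum>b<k. cnj (\<theta> a) * \<theta> b * M b a I J)"
    proof (intro sum.cong refl)
      fix a b assume "a \<in> {..<k}" "b \<in> {..<k}"
      then have "form_cnj (M a b) = M b a"
        using hermD(2) by simp
      then show "cnj (\<theta> a) * \<theta> b * form_cnj (M a b) I J = cnj (\<theta> a) * \<theta> b * M b a I J"
        by simp
    qed
    also have "\<dots> = ?\<alpha> I J"
      by (subst sum.swap) (simp add: mult_ac)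
    finally show "form_cnj ?\<alpha> I J = ?\<alpha> I J" .
  qed
  moreover have "0 < Re (\<Sum>\<mu><n. \<Sum>\<nu><n. herm_coeff ?\<alpha> \<mu> \<nu> * u \<mu> * cnj (u \<nu>))"
    if "\<exists>\<mu><n. u \<mu> \<noteq> 0" for u :: "nat \<Rightarrow> complex"
  proof -
    define v where "v a \<mu> = \<theta> a * u \<mu>" for a \<mu>
    have "\<exists>a<k. \<exists>\<mu><n. v a \<mu> \<noteq> 0" using a that by (auto simp: v_def)
    then have "0 < Re (\<Sum>a<k. \<Sum>b<k. \<Sum>\<mu><n. \<Sum>\<nu><n.
                  herm_coeff (M a b) \<mu> \<nu> * v a \<mu> * cnj (v b \<nu>))"
      using assms by (simp add: nakano_positive_def)
    also have "(\<Sum>a<k. \<Sum>b<k. \<Sum>\<mu><n. \<Sum>\<nu><n. herm_coeff (M a b) \<mu> \<nu> * v a \<mu> * cnj (v b \<nu>))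
      = (\<Sum>\<mu><n. \<Sum>a<k. \<Sum>b<k. \<Sum>\<nu><n. herm_coeff (M a b) \<mu> \<nu> * v a \<mu> * cnj (v b \<nu>))"
      by (subst (2) sum.swap, subst sum.swap) (rule refl)
    also have "\<dots> = (\<Sum>\<mu><n. \<Sum>\<nu><n. \<Sum>a<k. \<Sum>b<k. herm_coeff (M a b) \<mu> \<nu> * v a \<mu> * cnj (v b \<nu>))"
      by (subst (2) sum.swap, subst (3) sum.swap) (rule refl)
    also have "\<dots> = (\<Sum>\<mu><n. \<Sum>\<nu><n. herm_coeff ?\<alpha> \<mu> \<nu> * u \<mu> * cnj (u \<nu>))"
      by (intro sum.cong refl)
        (simp add: v_def herm_coeff_def sum_distrib_left sum_distrib_right sum_divide_distrib mult_ac)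
    finally show ?thesis .
  qed
  ultimately show "kaehler n ?\<alpha>"
    by (simp add: kaehler_def real_forms_def)
qed

text \<open>Written with indicators, the fourfold sum in the definition of Nakano positivity
  collapses, term by term, to a sum of squares and six single entries.\<close>

lemma coupling_decomp:
  "coupling p T a b \<mu> \<nu> = of_bool (a = b \<and> \<mu> = \<nu>)
     + of_real T * of_bool (a = 1 \<and> b = 1 \<and> \<mu> = 1 \<and> \<nu> = 1)
     + of_real T * of_bool (a = 1 \<and> b = 1 \<and> \<mu> = 3 \<and> \<nu> = 3)
     + of_real p * of_bool (a = 0 \<and> b = 1 \<and> \<mu> = 0 \<and> \<nu> = 1)
     + of_real p * of_bool (a = 0 \<and> b = 1 \<and> \<mu> = 2 \<and> \<nu> = 3)
     + of_real p * of_bool (a = 1 \<and> b = 0 \<and> \<mu> = 1 \<and> \<nu> = 0)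
     + of_real p * of_bool (a = 1 \<and> b = 0 \<and> \<mu> = 3 \<and> \<nu> = 2)"
  by (cases "a = b") (auto simp: coupling_def)

lemma sum_pick_diag:
  fixes c :: "nat \<Rightarrow> nat \<Rightarrow> nat \<Rightarrow> nat \<Rightarrow> complex"
  shows "(\<Sum>a<k. \<Sum>b<k. \<Sum>\<mu><n. \<Sum>\<nu><n. of_bool (a = b \<and> \<mu> = \<nu>) * c a b \<mu> \<nu>)
    = (\<Sum>a<k. \<Sum>\<mu><n. c a a \<mu> \<mu>)"
proof -
  have pick: "(\<Sum>i<N. of_bool (j = i) * g i) = g j" if "j < N" for j N and g :: "nat \<Rightarrow> complex"
  proof -
    have "(\<Sum>i<N. of_bool (j = i) * g i) = (\<Sum>i<N. if i = j then g i else 0)"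
      by (intro sum.cong) auto
    then show ?thesis using that by simp
  qed
  have "(\<Sum>a<k. \<Sum>b<k. \<Sum>\<mu><n. \<Sum>\<nu><n. of_bool (a = b \<and> \<mu> = \<nu>) * c a b \<mu> \<nu>)
    = (\<Sum>a<k. \<Sum>b<k. of_bool (a = b) * (\<Sum>\<mu><n. \<Sum>\<nu><n. of_bool (\<mu> = \<nu>) * c a b \<mu> \<nu>))"
    by (simp only: of_bool_conj mult.assoc sum_distrib_left)
  also have "\<dots> = (\<Sum>a<k. \<Sum>\<mu><n. \<Sum>\<nu><n. of_bool (\<mu> = \<nu>) * c a a \<mu> \<nu>)"
    by (intro sum.cong refl pick) simp
  also have "\<dots> = (\<Sum>a<k. \<Sum>\<mu><n. c a a \<mu> \<mu>)"
    by (intro sum.cong refl pick) simp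
  finally show ?thesis .
qed

lemma sum_pick4:
  fixes c :: "nat \<Rightarrow> nat \<Rightarrow> nat \<Rightarrow> nat \<Rightarrow> complex"
  assumes "a0 < k" "b0 < k" "m0 < n" "n0 < n"
  shows "(\<Sum>a<k. \<Sum>b<k. \<Sum>\<mu><n. \<Sum>\<nu><n.
      of_bool (a = a0 \<and> b = b0 \<and> \<mu> = m0 \<and> \<nu> = n0) * c a b \<mu> \<nu>) = c a0 b0 m0 n0"
proof -
  have pick: "(\<Sum>i<N. of_bool (i = j) * g i) = g j" if "j < N" for j N and g :: "nat \<Rightarrow> complex"
  proof -
    have "(\<Sum>i<N. of_bool (i = j) * g i) = (\<Sum>i<N. if i = j then g i else 0)"
      by (intro sum.cong) auto
    then show ?thesis using that by simp
  qed
  show ?thesis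
    by (simp only: of_bool_conj mult.assoc sum_distrib_left[symmetric] pick assms)
qed

text \<open>Completing the square leaves (1 + T - p^2) |y|^2, and the assumption makes this
  coefficient positive.\<close>

lemma two_by_two_pos:
  fixes x y :: complex and p T :: real
  assumes "p\<^sup>2 < 1 + T"
  shows "0 \<le> (cmod x)\<^sup>2 + (1 + T) * (cmod y)\<^sup>2 + 2 * p * Re (x * cnj y)"
    and "x \<noteq> 0 \<or> y \<noteq> 0 \<Longrightarrow> 0 < (cmod x)\<^sup>2 + (1 + T) * (cmod y)\<^sup>2 + 2 * p * Re (x * cnj y)"
proof -
  have eq: "(cmod x)\<^sup>2 + (1 + T) * (cmod y)\<^sup>2 + 2 * p * Re (x * cnj y)
      = (cmod (x + of_real p * y))\<^sup>2 + (1 + T - p\<^sup>2) * (cmod y)\<^sup>2"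
    unfolding cmod_power2 by (simp add: power2_eq_square algebra_simps)
  show "0 \<le> (cmod x)\<^sup>2 + (1 + T) * (cmod y)\<^sup>2 + 2 * p * Re (x * cnj y)"
    unfolding eq using assms by simp
  assume "x \<noteq> 0 \<or> y \<noteq> 0"
  then show "0 < (cmod x)\<^sup>2 + (1 + T) * (cmod y)\<^sup>2 + 2 * p * Re (x * cnj y)"
    unfolding eq using assms by (cases "y = 0") (auto intro!: add_nonneg_pos)
qed

lemma nakano_positive_coupling:
  assumes "4 \<le> n" "2 \<le> k" "p\<^sup>2 < 1 + T"
  shows "nakano_positive n k (coupling_matrix n p T)"
  unfolding nakano_positive_def
proof (intro conjI allI impI herm_matrix_coupling)
  fix u :: "nat \<Rightarrow> nat \<Rightarrow> complex"
  assume "\<exists>a<k. \<exists>\<mu><n. u a \<mu> \<noteq> 0"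
  then obtain a0 m0 where nz: "a0 < k" "m0 < n" "u a0 m0 \<noteq> 0" by blast
  \<comment> \<open>\<open>?X\<close> collects the coordinates that the matrix couples: (0,0) with
    (1,1), and (0,2) with (1,3). Each pair gives one block \<open>?Q\<close>; every coordinate
    outside \<open>?X\<close> enters only through its squared modulus.\<close>
  let ?P = "{..<k} \<times> {..<n}" and ?X = "{(0, 0), (0, 2), (1, 1), (1, 3)} :: (nat \<times> nat) set"
  let ?s = "\<lambda>a \<mu>. (cmod (u a \<mu>))\<^sup>2"
  let ?Q = "\<lambda>x y. (cmod x)\<^sup>2 + (1 + T) * (cmod y)\<^sup>2 + 2 * p * Re (x * cnj y)"
  let ?c = "\<lambda>a b \<mu> \<nu>. u a \<mu> * cnj (u b \<nu>)"
  let ?H = "\<Sum>a<k. \<Sum>b<k. \<Sum>\<mu><n. \<Sum>\<nu><n. herm_coeff (coupling_matrix n p T a b) \<mu> \<nu> * u a \<mu> * cnj (u b \<nu>)"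
  have bounds: "0 < k" "1 < k" "0 < n" "1 < n" "2 < n" "3 < n"
    using assms(1,2) by auto
  have "?H = (\<Sum>a<k. \<Sum>b<k. \<Sum>\<mu><n. \<Sum>\<nu><n. coupling p T a b \<mu> \<nu> * ?c a b \<mu> \<nu>)"
  proof (intro sum.cong refl)
    fix a b \<mu> \<nu> assume "\<mu> \<in> {..<n}" "\<nu> \<in> {..<n}"
    then have "herm_coeff (coupling_matrix n p T a b) \<mu> \<nu> = coupling p T a b \<mu> \<nu>"
      by (simp add: herm_coeff_def coupling_matrix_def)
    then show "herm_coeff (coupling_matrix n p T a b) \<mu> \<nu> * u a \<mu> * cnj (u b \<nu>)
        = coupling p T a b \<mu> \<nu> * ?c a b \<mu> \<nu>"
      by (simp only: mult.assoc)
  qed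
  also have "\<dots> = (\<Sum>a<k. \<Sum>b<k. \<Sum>\<mu><n. \<Sum>\<nu><n. of_bool (a = b \<and> \<mu> = \<nu>) * ?c a b \<mu> \<nu>)
      + of_real T * ?c 1 1 1 1 + of_real T * ?c 1 1 3 3
      + of_real p * ?c 0 1 0 1 + of_real p * ?c 0 1 2 3 + of_real p * ?c 1 0 1 0 + of_real p * ?c 1 0 3 2"
    by (simp only: coupling_decomp distrib_right mult.assoc sum.distrib
        sum_distrib_left[symmetric] sum_pick4 bounds)
  also have "(\<Sum>a<k. \<Sum>b<k. \<Sum>\<mu><n. \<Sum>\<nu><n. of_bool (a = b \<and> \<mu> = \<nu>) * ?c a b \<mu> \<nu>)
      = (\<Sum>a<k. \<Sum>\<mu><n. ?c a a \<mu> \<mu>)"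
    by (rule sum_pick_diag)
  also have "\<dots> = of_real (\<Sum>(a, \<mu>)\<in>?P. ?s a \<mu>)"
    unfolding sum.cartesian_product of_real_sum
    by (intro sum.cong refl) (simp only: complex_norm_square split_beta)
  also have "(\<Sum>(a, \<mu>)\<in>?P. ?s a \<mu>) = (\<Sum>(a, \<mu>)\<in>?P - ?X. ?s a \<mu>) + (\<Sum>(a, \<mu>)\<in>?X. ?s a \<mu>)"
    using assms(1,2) by (intro sum.subset_diff) auto
  finally have "Re ?H = (\<Sum>(a, \<mu>)\<in>?P - ?X. ?s a \<mu>) + ?Q (u 0 0) (u 1 1) + ?Q (u 0 2) (u 1 3)"
    by (simp add: algebra_simps cmod_power2 power2_eq_square[of "Re x" for x]
        power2_eq_square[of "Im x" for x])
  moreover have "0 < (\<Sum>(a, \<mu>)\<in>?P - ?X. ?s a \<mu>) + ?Q (u 0 0) (u 1 1) + ?Q (u 0 2) (u 1 3)"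
  proof -
    have S0: "0 \<le> (\<Sum>(a, \<mu>)\<in>?P - ?X. ?s a \<mu>)" by (intro sum_nonneg) auto
    note Q0 = two_by_two_pos[OF assms(3), of "u 0 0" "u 1 1"]
      two_by_two_pos[OF assms(3), of "u 0 2" "u 1 3"]
    show ?thesis
    proof (cases "(a0, m0) \<in> ?X")
      case True
      then have "u 0 0 \<noteq> 0 \<or> u 1 1 \<noteq> 0 \<or> u 0 2 \<noteq> 0 \<or> u 1 3 \<noteq> 0"
        using nz(3) by auto
      with S0 Q0 show ?thesis by linarith
    next
      case False
      have "0 < (\<Sum>(a, \<mu>)\<in>?P - ?X. ?s a \<mu>)"
        by (rule sum_pos2[of _ "(a0, m0)"]) (use nz False in auto)
      with Q0(1,3) show ?thesis by linarith
    qed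
  qed
  ultimately show "0 < Re ?H" by simp
qed

section \<open>The kernel of the Lefschetz map\<close>

text \<open>Up to a constant factor, the form \<open>(\<Sum>i<4. x i e\<^sub>i) \<and> d\<bar>z\<^sub>J\<close> with \<open>J = {r..<n}\<close>.\<close>

definition kernel_form :: "nat \<Rightarrow> nat \<Rightarrow> (nat \<Rightarrow> complex) \<Rightarrow> form" where
  "kernel_form n r x = (\<lambda>I L. if \<exists>i<4. I = {i} \<and> L = insert i {r..<n} then x (the_elem I) else 0)"

lemma kernel_form_simps:
  "i < 4 \<Longrightarrow> kernel_form n r x {i} (insert i {r..<n}) = x i"
  "kernel_form n r x I L \<noteq> 0 \<Longrightarrow> \<exists>i<4. I = {i} \<and> L = insert i {r..<n}"
  by (auto simp: kernel_form_def split: if_splits)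

lemma kernel_form_in_forms:
  assumes "4 \<le> r" "r \<le> n"
  shows "kernel_form n r x \<in> forms n 1 (n - r + 1)"
  unfolding forms_def
  using assms by (auto dest!: kernel_form_simps(2))

text \<open>Every term of \<open>kernel_form\<close> contains both differentials of some index i <
  4, while every term of \<open>R\<close> contains at least one of them, so a differential is
  repeated.\<close>

lemma wedge_kernel_form_cross:
  assumes "\<And>I J. R I J \<noteq> 0 \<Longrightarrow> {0, 1, 2, 3} \<subseteq> I \<union> J"
  shows "wedge (kernel_form n r x) R = (\<lambda>_ _. 0)"
proof -
  have "kernel_form n r x I L * R (K - I) (K' - L) = 0" for I L K K'
  proof (rule ccontr)
    assume "\<not> ?thesis"
    then obtain i where "i < 4" "I = {i}" "L = insert i {r..<n}" "{0, 1, 2, 3} \<subseteq> (K - I) \<union> (K' - L)"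
      using kernel_form_simps(2) assms by (metis mult_eq_0_iff)
    then have "i \<in> {0, 1, 2, 3}" "i \<notin> {0, 1, 2, 3}" by auto
    then show False by blast
  qed
  then show ?thesis
    unfolding wedge_def
    by (intro ext sum.neutral ballI) (simp only: mult.assoc mult_zero_right)
qed

text \<open>All of \<open>S\<close> lies below \<open>r\<close>, so each of the elements r, ..., n -
  1 is inverted with every element of \<open>S\<close>.\<close>

lemma shuffle_sign_insert_above:
  assumes "S \<subseteq> {..<r}" "i < r"
  shows "shuffle_sign (insert i {r..<n}) S = shuffle_sign {i} S * (-1) ^ ((n - r) * card S)"
proof -
  have fin: "finite S" using assms(1) finite_subset by blast
  have "{(a, j). a \<in> insert i {r..<n} \<and> j \<in> S \<and> j < a}
      = {(a, j). a \<in> {i} \<and> j \<in> S \<and> j < a} \<union> {r..<n} \<times> S"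
    using assms by auto
  moreover have "card ({(a, j). a \<in> {i} \<and> j \<in> S \<and> j < a} \<union> {r..<n} \<times> S)
     = card {(a, j). a \<in> {i} \<and> j \<in> S \<and> j < a} + card ({r..<n} \<times> S)"
  proof (rule card_Un_disjoint)
    show "finite {(a, j). a \<in> {i} \<and> j \<in> S \<and> j < a}"
      by (rule finite_subset[of _ "{i} \<times> S"]) (use fin in auto)
  qed (use fin assms in auto)
  ultimately show ?thesis
    by (simp add: shuffle_sign_def card_cartesian_product power_add)
qed

text \<open>The conjugate differentials with indices from \<open>r\<close> on leave only the first
  \<open>r\<close> variables free. There all terms of a coefficient share one sign, so the wedge
  vanishes once the sign-free sums in the last assumption do.\<close>

lemma wedge_kernel_form_diag:
  assumes r: "4 \<le> r" "r \<le> n"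
    and zero: "\<And>K. K \<subseteq> {..<r} \<Longrightarrow> (\<Sum>i\<in>K \<inter> {..<4}. x i * c (K - {i})) = 0"
  shows "wedge (kernel_form n r x) (diag_form n c) = (\<lambda>_ _. 0)"
proof (intro ext)
  fix K L :: "nat set"
  let ?J = "{r..<n}"
  let ?t = "\<lambda>I I'. (-1) ^ (card I' * card (K - I)) * shuffle_sign I (K - I)
        * shuffle_sign I' (L - I') * kernel_form n r x I I' * diag_form n c (K - I) (L - I')"
  \<comment> \<open>A nonzero term forces K - {i} and L minus \<open>insert i ?J\<close> to be
    equal; this set avoids \<open>?J\<close> and lies below \<open>n\<close>, hence below
    \<open>r\<close>, and i < 4 is below \<open>r\<close> as well.\<close>
  have t0: "\<exists>i<4. i \<in> K \<and> I = {i} \<and> I' = insert i ?J \<and> L = K \<union> ?J \<and> K \<subseteq> {..<r}"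
    if "I \<subseteq> K" "I' \<subseteq> L" "?t I I' \<noteq> 0" for I I'
  proof -
    have "kernel_form n r x I I' \<noteq> 0" "diag_form n c (K - I) (L - I') \<noteq> 0"
      using that(3) by auto
    then obtain i where i: "i < 4" "I = {i}" "I' = insert i ?J"
      and KL: "K - {i} = L - insert i ?J" "K - {i} \<subseteq> {..<n}"
      using kernel_form_simps(2)[of n r x I I'] by (auto simp: diag_form_def split: if_splits)
    have "L = K \<union> ?J" using KL(1) that(1,2) i by blast
    moreover have "K \<subseteq> {..<r}"
    proof
      fix j assume "j \<in> K"
      then have "j = i \<or> j \<in> L - insert i ?J" "j = i \<or> j < n"
        using KL by blast+
      then show "j \<in> {..<r}"
        using i(1) r by auto
    qed
    ultimately show ?thesis using i that(1) by auto
  qed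
  show "wedge (kernel_form n r x) (diag_form n c) K L = 0"
  proof (cases "L = K \<union> ?J \<and> K \<subseteq> {..<r}")
    case False
    then have "?t I I' = 0" if "I \<subseteq> K" "I' \<subseteq> L" for I I'
      using t0[OF that] by blast
    then show ?thesis
      unfolding wedge_def by (intro sum.neutral ballI) (metis PowD)
  next
    case True
    then have L: "L = K \<union> ?J" and K: "K \<subseteq> {..<r}" by auto
    then have fin: "finite K" "finite L" by (auto intro: finite_subset[OF _ finite_lessThan])
    txt \<open>The shuffle signs square away: all terms carry the same factor \<open>?C\<close>.\<close>
    let ?C = "(-1) ^ ((n - r + 1) * (card K - 1)) * (-1) ^ ((n - r) * (card K - 1)) * diag_sign (card K - 1)"
    have t: "?t {i} (insert i ?J) = ?C * (x i * c (K - {i}))" if "i \<in> K" "i < 4" for i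
    proof -
      have sets: "L - insert i ?J = K - {i}" "K - {i} \<subseteq> {..<n}" "K - {i} \<subseteq> {..<r}"
        using L K r by auto
      have cards: "card (insert i ?J) = n - r + 1" "card (K - {i}) = card K - 1"
        using that r fin by auto
      have "?t {i} (insert i ?J) = (-1) ^ ((n - r + 1) * (card K - 1))
         * (shuffle_sign {i} (K - {i}) * shuffle_sign {i} (K - {i})) * (-1) ^ ((n - r) * (card K - 1))
         * x i * (diag_sign (card K - 1) * c (K - {i}))"
        using that r shuffle_sign_insert_above[OF sets(3), of i n] sets(2)
        by (simp add: sets(1) cards kernel_form_simps(1) diag_form_def)
      then show ?thesis
        by (simp only: shuffle_sign_square) simp
    qed
    have "wedge (kernel_form n r x) (diag_form n c) K L = (\<Sum>I\<in>Pow K. \<Sum>I'\<in>Pow L. ?t I I')"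
      by (simp add: wedge_def)
    also have "\<dots> = (\<Sum>i\<in>K. \<Sum>I'\<in>Pow L. ?t {i} I')"
    proof (rule sum_Pow_singletons[OF fin(1)], rule sum.neutral, rule ballI, rule ccontr)
      fix I I' assume "I \<subseteq> K" "\<not> is_singleton I" "I' \<in> Pow L" "?t I I' \<noteq> 0"
      then show False using t0[of I I'] by (auto simp: is_singleton_def)
    qed
    also have "\<dots> = (\<Sum>i\<in>K \<inter> {..<4}. \<Sum>I'\<in>Pow L. ?t {i} I')"
    proof (rule sum.mono_neutral_right[OF fin(1)])
      show "\<forall>i\<in>K - K \<inter> {..<4}. (\<Sum>I'\<in>Pow L. ?t {i} I') = 0"
      proof (intro ballI sum.neutral, rule ccontr)
        fix i I' assume "i \<in> K - K \<inter> {..<4}" "I' \<in> Pow L" "?t {i} I' \<noteq> 0"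
        then show False using t0[of "{i}" I'] by auto
      qed
    qed auto
    also have "\<dots> = (\<Sum>i\<in>K \<inter> {..<4}. ?C * (x i * c (K - {i})))"
    proof (rule sum.cong[OF refl])
      fix i assume i: "i \<in> K \<inter> {..<4}"
      have "(\<Sum>I'\<in>Pow L. ?t {i} I') = (\<Sum>I'\<in>{insert i ?J}. ?t {i} I')"
      proof (rule sum.mono_neutral_right)
        show "\<forall>I'\<in>Pow L - {insert i ?J}. ?t {i} I' = 0"
        proof (rule ballI, rule ccontr)
          fix I' assume "I' \<in> Pow L - {insert i ?J}" "?t {i} I' \<noteq> 0"
          then show False using t0[of "{i}" I'] i by auto
        qed
      qed (use fin i L in auto)
      then show "(\<Sum>I'\<in>Pow L. ?t {i} I') = ?C * (x i * c (K - {i}))"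
        using t[of i] i by simp
    qed
    also have "\<dots> = 0"
      using zero[OF K] by (simp only: sum_distrib_left[symmetric]) simp
    finally show ?thesis .
  qed
qed

section \<open>The kernel equations and their solution\<close>

definition kernel_coeff :: "nat \<Rightarrow> nat \<Rightarrow> complex" where
  "kernel_coeff m i = (if i = 0 then 1 else if i = 1 then of_nat (2 * m + 3)
     else if i = 2 then -1 else - of_nat (2 * m + 3))"

text \<open>Here k = m + 2 and N = 2 m + 3. Only sets of k + 1 elements matter, and inside k + 2
  variables such a set omits exactly one index j, so five cases remain: j = 0, 1, 2, 3 or j beyond
  3.\<close>

lemma kernel_coeff_det_coeff:
  assumes p: "p\<^sup>2 = real ((m + 2) * (m + 1) * (2 * m + 3))"
    and T: "T = real (2 * (m + 2)\<^sup>2 * (m + 1))"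
    and K: "K \<subseteq> {..<m + 4}"
  shows "(\<Sum>i\<in>K \<inter> {..<4}. kernel_coeff m i * det_coeff p T (m + 2) (K - {i})) = 0"
proof -
  have fin: "finite K" using K finite_subset by blast
  show ?thesis
  proof (cases "card K = m + 3")
    case False
    have "det_coeff p T (m + 2) (K - {i}) = 0" if "i \<in> K" for i
      using card_Suc_Diff1[OF fin that] False by (simp add: det_coeff_def)
    then show ?thesis by (intro sum.neutral) auto
  next
    case True
    have "card ({..<m + 4} - K) = 1"
      using card_Diff_subset[OF fin K] True by simp
    then obtain j where j: "{..<m + 4} - K = {j}"
      by (auto simp: card_1_singleton_iff)
    have mem: "i \<in> K \<longleftrightarrow> i \<noteq> j" if "i < 4" for i
      using j that by (metis Diff_iff insertI1 lessThan_iff singletonD trans_less_add2)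
    note mems = mem[of 0] mem[of 1] mem[of 2] mem[of 3]
    let ?M = "of_nat m :: complex"
    let ?P = "(?M + 2) * (?M + 1) * (2 * ?M + 3)" and ?T = "2 * (?M + 2)\<^sup>2 * (?M + 1)"
    \<comment> \<open>Membership in K - {i} is expressed by inequalities with the omitted index
      \<open>j\<close>, so that each case becomes a polynomial identity in \<open>m\<close>.\<close>
    define f where "f i = kernel_coeff m i * (fact m * ((?M + 2) * (?M + 1)
         + ?T * (?M + 1) * (of_bool (1 \<noteq> j \<and> 1 \<noteq> i) + of_bool (3 \<noteq> j \<and> 3 \<noteq> i))
         + ?P * (of_bool (0 \<noteq> j \<and> 1 \<noteq> j \<and> 0 \<noteq> i \<and> 1 \<noteq> i)
            + of_bool (2 \<noteq> j \<and> 3 \<noteq> j \<and> 2 \<noteq> i \<and> 3 \<noteq> i))))" for i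
    have fact2: "fact (m + 2) = (?M + 2) * (?M + 1) * fact m" "fact (m + 1) = (?M + 1) * fact m"
      by (simp_all add: algebra_simps)
    have PT: "of_real (p\<^sup>2) = ?P" "of_real T = ?T"
      unfolding p T by (simp_all add: power2_eq_square algebra_simps)
    have f: "kernel_coeff m i * det_coeff p T (m + 2) (K - {i}) = f i" if "i \<in> K \<inter> {..<4}" for i
    proof -
      have "card (K - {i}) = m + 2"
        using card_Suc_Diff1[OF fin, of i] that True by auto
      then have "det_coeff p T (m + 2) (K - {i}) = fact (m + 2)
        + of_real T * fact (m + 1) * (of_bool (1 \<in> K - {i}) + of_bool (3 \<in> K - {i}))
        + of_real (p\<^sup>2) * fact m * (of_bool (0 \<in> K - {i} \<and> 1 \<in> K - {i}) + of_bool (2 \<in> K - {i} \<and> 3 \<in> K - {i}))"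
        unfolding det_coeff_def by simp
      moreover have "(1 \<in> K - {i}) = (1 \<noteq> j \<and> 1 \<noteq> i)" "(3 \<in> K - {i}) = (3 \<noteq> j \<and> 3 \<noteq> i)"
        "(0 \<in> K - {i} \<and> 1 \<in> K - {i}) = (0 \<noteq> j \<and> 1 \<noteq> j \<and> 0 \<noteq> i \<and> 1 \<noteq> i)"
        "(2 \<in> K - {i} \<and> 3 \<in> K - {i}) = (2 \<noteq> j \<and> 3 \<noteq> j \<and> 2 \<noteq> i \<and> 3 \<noteq> i)"
        using mems by auto
      ultimately show ?thesis
        unfolding f_def fact2 PT by (simp only:) (simp only: algebra_simps)
    qed
    have "(\<Sum>i\<in>K \<inter> {..<4}. kernel_coeff m i * det_coeff p T (m + 2) (K - {i})) = (\<Sum>i\<in>{..<4} - {j}. f i)"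
    proof (rule sum.cong)
      show "K \<inter> {..<4} = {..<4} - {j}" using mem by auto
    qed (use f mem in auto)
    also have "\<dots> = 0"
    proof -
      consider "j = 0" | "j = 1" | "j = 2" | "j = 3" | "j \<notin> {0, 1, 2, 3}" by auto
      then show ?thesis
      proof cases
        \<comment> \<open>With the common factor removed, this is N p^2 = k (k - 1) + 2 T (k -
          1).\<close>
        case 1
        then have "{..<4} - {j} = {1, 2, 3}" by auto
        with 1 show ?thesis
          by (simp add: f_def kernel_coeff_def power2_eq_square algebra_simps)
      next
        \<comment> \<open>This is p^2 = N k (k - 1).\<close>
        case 2
        then have "{..<4} - {j} = {0, 2, 3}" by auto
        with 2 show ?thesis
          by (simp add: f_def kernel_coeff_def power2_eq_square algebra_simps)
      next
        \<comment> \<open>Exchanging 0 with 2 and 1 with 3 preserves the weights and negates the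
          coefficients, so omitting 2 or 3 gives the equations for 0 and 1 again.\<close>
        case 3
        then have "{..<4} - {j} = {0, 1, 3}" by auto
        with 3 show ?thesis
          by (simp add: f_def kernel_coeff_def power2_eq_square algebra_simps)
      next
        case 4
        then have "{..<4} - {j} = {0, 1, 2}" by auto
        with 4 show ?thesis
          by (simp add: f_def kernel_coeff_def power2_eq_square algebra_simps)
      next
        \<comment> \<open>No index below 4 is omitted, and the terms for 0 and 2, and for 1 and 3,
          cancel by the same exchange.\<close>
        case 5
        then have "{..<4} - {j} = {0, 1, 2, 3}" by auto
        with 5 show ?thesis
          by (simp add: f_def kernel_coeff_def power2_eq_square algebra_simps)
      qed
    qed
    finally show ?thesis .
  qed
qed

section \<open>From a kernel element to the two cones\<close>

lemma lefschetz_imp_no_kernel: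
  assumes "lefschetz n \<Omega> p q" "\<alpha> \<in> forms n p q" "wedge \<alpha> \<Omega> = (\<lambda>_ _. 0)"
  shows "\<alpha> = (\<lambda>_ _. 0)"
proof -
  have "inj_on (lefschetz_map \<Omega>) (forms n p q)"
    using assms(1) by (simp add: lefschetz_def bij_betw_def)
  moreover have "lefschetz_map \<Omega> \<alpha> = lefschetz_map \<Omega> (\<lambda>_ _. 0)"
    using assms(3) by (simp add: lefschetz_map_def wedge_zero_left)
  moreover have "(\<lambda>_ _. 0) \<in> forms n p q"
    by (simp add: forms_def)
  ultimately show ?thesis
    using assms(2) by (meson inj_onD)
qed

text \<open>The path starts at \<Omega>, and for r = 0 the extra factor is the empty power, so the
  condition at t = 0 and r = 0 is the Lefschetz property of \<Omega> itself.\<close>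

lemma hodge_riemann_cone_imp_lefschetz:
  assumes "\<Omega> \<in> hodge_riemann_cone n k \<omega>" "p + q + k = n"
  shows "lefschetz n \<Omega> p q"
proof -
  have \<Omega>: "\<Omega> \<in> forms n k k" and "hodge_riemann_for n k \<omega> \<Omega> p q"
    using assms by (auto simp: hodge_riemann_cone_def real_forms_def)
  then obtain \<gamma> where "pathstart \<gamma> = \<Omega>"
    and "\<forall>t\<in>{0..1}. \<forall>r\<le>min p q. lefschetz n (wedge (\<gamma> t) (form_pow \<omega> (2 * r))) (p - r) (q - r)"
    unfolding hodge_riemann_for_def by auto
  then have "lefschetz n (wedge \<Omega> (form_pow \<omega> (2 * 0))) (p - 0) (q - 0)"
    unfolding pathstart_def by (metis atLeastAtMost_iff le0 order_refl zero_le_one)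
  then show ?thesis
    by (simp add: form_pow_def wedge_form_one[OF \<Omega>])
qed

theorem theorem1:
  fixes n k :: nat
  assumes "n \<ge> 4" and "2 \<le> k" and "k \<le> n - 2"
  shows "\<exists>M. nakano_positive n k M
           \<and> \<not> lefschetz n (form_det k M) 1 (n - k - 1)
           \<and> form_det k M \<in> griffiths_cone n k
           \<and> (\<forall>\<omega>. kaehler n \<omega> \<longrightarrow> form_det k M \<notin> hodge_riemann_cone n k \<omega>)"
proof -
  obtain m where k: "k = m + 2"
    using assms(2) by (metis add.commute le_Suc_ex)
  define p where "p = sqrt (real ((m + 2) * (m + 1) * (2 * m + 3)))"
  define T where "T = real (2 * (m + 2)\<^sup>2 * (m + 1))"
  define M where "M = coupling_matrix n p T"
  \<comment> \<open>The bound m + 4 = k + 2 is at most \<open>n\<close> by assumption; for k = n - 2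
    the set of extra conjugate indices is empty.\<close>
  let ?\<alpha> = "kernel_form n (m + 4) (kernel_coeff m)"
  have p: "p\<^sup>2 = real ((m + 2) * (m + 1) * (2 * m + 3))"
    unfolding p_def by (rule real_sqrt_pow2) simp
  \<comment> \<open>After division by (m + 2) (m + 1) the leading terms compare as 2 m + 3 < 2 m +
    4, which gives p^2 < T.\<close>
  have "(m + 2) * (m + 1) * (2 * m + 3) < 1 + 2 * (m + 2)\<^sup>2 * (m + 1)"
    by (simp add: power2_eq_square algebra_simps)
  then have "real ((m + 2) * (m + 1) * (2 * m + 3)) < real (1 + 2 * (m + 2)\<^sup>2 * (m + 1))"
    by (simp only: of_nat_less_iff)
  then have "p\<^sup>2 < 1 + T"
    unfolding p T_def by (simp only: of_nat_add of_nat_1)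
  then have nakano: "nakano_positive n k M"
    unfolding M_def using assms by (intro nakano_positive_coupling)
  have not_lefschetz: "\<not> lefschetz n (form_det k M) 1 (n - k - 1)"
  proof
    assume L: "lefschetz n (form_det k M) 1 (n - k - 1)"
    obtain R where \<Omega>: "form_det k M = (\<lambda>I J. diag_form n (det_coeff p T k) I J + R I J)"
      and R: "\<And>I J. R I J \<noteq> 0 \<Longrightarrow> {0, 1, 2, 3} \<subseteq> I \<union> J"
      unfolding M_def using form_det_coupling[OF assms(1,2)] by metis
    have "n - k - 1 = n - (m + 4) + 1" "m + 4 \<le> n"
      using k assms by auto
    then have \<alpha>: "?\<alpha> \<in> forms n 1 (n - k - 1)"
      using kernel_form_in_forms[of "m + 4" n] by simp
    have "wedge ?\<alpha> (diag_form n (det_coeff p T k)) = (\<lambda>_ _. 0)"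
      unfolding k using \<open>m + 4 \<le> n\<close>
      by (intro wedge_kernel_form_diag kernel_coeff_det_coeff[OF p T_def]) simp_all
    moreover have "wedge ?\<alpha> R = (\<lambda>_ _. 0)"
      using R by (rule wedge_kernel_form_cross)
    ultimately have "wedge ?\<alpha> (form_det k M) = (\<lambda>_ _. 0)"
      unfolding \<Omega> wedge_add_right by simp
    with L \<alpha> have "?\<alpha> = (\<lambda>_ _. 0)"
      by (rule lefschetz_imp_no_kernel)
    \<comment> \<open>One coefficient equal to 1 shows that the kernel element is nonzero.\<close>
    moreover have "?\<alpha> {0} (insert 0 {m + 4..<n}) = 1"
      by (simp add: kernel_form_simps kernel_coeff_def)
    ultimately show False by simp
  qed
  have "form_det k M \<in> griffiths_cone n k"
    unfolding griffiths_cone_def using nakano_imp_griffiths[OF nakano] by blast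
  moreover have "form_det k M \<notin> hodge_riemann_cone n k \<omega>" for \<omega>
    using not_lefschetz hodge_riemann_cone_imp_lefschetz[of _ n k \<omega> 1 "n - k - 1"] k assms by auto
  ultimately show ?thesis
    using nakano not_lefschetz by blast
qed

end
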